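(* Let $\rho_1,\rho_2:W_F\to\mathrm{GL}_2(\overline{\mathbb{Q}}_\ell)$ be a principal series and a special representation, respectively, such that $\rho_1(W_F),\rho_2(W_F)\subset\mathrm{GL}_2(\mathcal{O}_K)$, with associated Weil--Deligne representations $\chi_1\oplus\chi_2$ and $\chi\omega\oplus\chi$, where $\chi_1,\chi_2,\chi$ are $1$-dimensional representations of $W_F$. Suppose (as may be assumed without loss of generality) that there are upper triangular matrices $U_j=\begin{pmatrix}a_j&b_j\\0&d_j\end{pmatrix}\in\mathrm{GL}_2(K)$, $j=1,2$, such that $$\rho_1(g)=\begin{pmatrix}\chi_1(g)&\frac{b_1}{d_1}(\chi_2(g)-\chi_1(g))\\0&\chi_2(g)\end{pmatrix}\quad (g\in W_F),$$ $$\rho_2(\Phi^k\tau)=\begin{pmatrix}\chi\omega(\Phi^k\tau)&\frac{a_2}{d_2}t_\ell(\tau)\chi\omega(\Phi^k\tau)+\frac{b_2}{d_2}(\chi(\Phi^k\tau)-\chi\omega(\Phi^k\tau))\\0&\chi(\Phi^k\tau)\end{pmatrix}\quad(k\in\mathbb{Z},\tau\in I_F).$$ Suppose that $a_2/d_2\in\mathcal{O}_K^\times$. Then $\overline{\rho}_1\cong\overline{\rho}_2$ if and only if $q\equiv1\pmod{\ell}$, $\overline{\chi}=\overline{\chi}_1=\overline{\chi}_2$, and there exists $x\in\mathcal{O}_K^\times$ such that $$\frac{b_1x}{d_1}\bigl(\chi_2(\Phi^k\tau)-\chi_1(\Phi^k\tau)\bigr)\equiv\frac{a_2}{d_2}t_\ell(\tau)\chi\omega(\Phi^k\tau)+\frac{b_2}{d_2}\bigl(\chi(\Phi^k\tau)-\chi\omega(\Phi^k\tau)\bigr)\pmod{\lambda}$$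 for all $\tau\in I_F$, $k\in\mathbb{Z}$.
   Context: $p\neq\ell$ are odd primes. $F/\mathbb{Q}_p$ is a finite extension with residue field of order $q$, Weil group $W_F$ and inertia group $I_F$. $\Phi\in W_F$ is a fixed Frobenius element, and $\omega$ is the character of $W_F$ with $\omega(\Phi^k\tau)=q^{-k}$ for $k\in\mathbb{Z}$, $\tau\in I_F$. $t_\ell:I_F\to\mathbb{Z}_\ell$ is a fixed continuous surjective homomorphism; it satisfies $t_\ell(g\tau g^{-1})=\omega(g)t_\ell(\tau)$ for $g\in W_F,\tau\in I_F$. $K/\mathbb{Q}_\ell$ is a finite extension with ring of integers $\mathcal{O}_K$ and maximal ideal $\lambda$. A bar denotes reduction modulo $\lambda$. The Weil--Deligne representation associated with a continuous $\rho:W_F\to \mathrm{GL}_2(\overline{\mathbb{Q}}_\ell)$ is $(\rho_\Phi,N_\rho)$, where $N_\rho$ is the unique nilpotent matrix with $\rho(\tau)=\exp(t_\ell(\tau)N_\rho)$ for $\tau$ in some open subgroup of $I_F$, and $\rho_\Phi(\Phi^k\tau)=\rho(\Phi^k\tau)\exp(-t_\ell(\tau)N_\rho)$. All representations are continuous. $\rho$ is called a principal series if its Weil--Deligne representation is isomorphic to $(\chi_1\oplus\chi_2,0)$ for $1$-dimensional representations $\chi_1,\chi_2$ of $W_F$ (then $\rho=\rho_\Phi$), and a special representation if its Weil--Deligne representation is isomorphic to $\left(\chi\omega\oplus\chi,\begin{pmatrix}0&1\\0&0\end{pmatrix}\right)$ for some $1$-dimensional representation $\chi$. *)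

theory Defs
  imports "HOL-Analysis.Analysis" "HOL-Algebra.Algebraic_Closure_Type"
    "HOL-Number_Theory.Cong"
begin

section \<open>Algebraic closures of p-adic fields\<close>

abbreviation field_of_type :: "'a::field_char_0 ring"
  where "field_of_type \<equiv> ring_of_type_algebra"

definition val_topology :: "('a::field_char_0 \<Rightarrow> real) \<Rightarrow> 'a topology"
  where "val_topology v = Metric_space.mtopology UNIV (\<lambda>x y. v (x - y))"

definition padics :: "('a::field_char_0 \<Rightarrow> real) \<Rightarrow> 'a set"
  where "padics v = val_topology v closure_of Rats"

text \<open>
  The type \<open>'a\<close> is an algebraic closure of the field of p-adic numbers and \<open>v\<close> is its absolute
  value, normalised so that \<open>v p = 1 / p\<close>: the closure \<open>padics v\<close> of the rational
  numbers is complete, hence is the completion of the rational numbers for the p-adic absolute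
  value, and \<open>'a\<close> is an algebraic closure of \<open>padics v\<close>.
\<close>

locale padic_closure =
  fixes p :: nat and v :: "'a::field_char_0 \<Rightarrow> real"
  assumes prime: "Factorial_Ring.prime p"
    and nonneg: "0 \<le> v x"
    and eq_0_iff: "v x = 0 \<longleftrightarrow> x = 0"
    and mult: "v (x * y) = v x * v y"
    and ultrametric: "v (x + y) \<le> max (v x) (v y)"
    and of_int: "n \<noteq> 0 \<Longrightarrow> v (of_int n) = 1 / real p ^ multiplicity (int p) n"
    and complete: "Metric_space.mcomplete (padics v) (\<lambda>x y. v (x - y))"
    and closure: "algebraic_closure (field_of_type :: 'a ring) (padics v)"

definition finite_ext_of_padics :: "('a::field_char_0 \<Rightarrow> real) \<Rightarrow> 'a set \<Rightarrow> bool"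
  where "finite_ext_of_padics v F \<longleftrightarrow>
    subfield F field_of_type \<and> padics v \<subseteq> F \<and> ring.finite_dimension field_of_type (padics v) F"

definition int_ring :: "('a::field_char_0 \<Rightarrow> real) \<Rightarrow> 'a set \<Rightarrow> 'a ring"
  where "int_ring v F = field_of_type\<lparr>carrier := {x \<in> F. v x \<le> 1}\<rparr>"

definition max_ideal :: "('a::field_char_0 \<Rightarrow> real) \<Rightarrow> 'a set \<Rightarrow> 'a set"
  where "max_ideal v F = {x \<in> F. v x < 1}"

definition residue_field :: "('a::field_char_0 \<Rightarrow> real) \<Rightarrow> 'a set \<Rightarrow> 'a set ring"
  where "residue_field v F = int_ring v F Quot max_ideal v F"

definition residue_card :: "('a::field_char_0 \<Rightarrow> real) \<Rightarrow> 'a set \<Rightarrow> nat"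
  where "residue_card v F = card (carrier (residue_field v F))"

definition residue :: "('a::field_char_0 \<Rightarrow> real) \<Rightarrow> 'a set \<Rightarrow> 'a \<Rightarrow> 'a set"
  where "residue v F x = max_ideal v F +>\<^bsub>int_ring v F\<^esub> x"


section \<open>Weil groups\<close>

definition abs_galois :: "'a::field_char_0 set \<Rightarrow> ('a \<Rightarrow> 'a) set"
  where "abs_galois F = {\<sigma> \<in> ring_iso field_of_type field_of_type. \<forall>x\<in>F. \<sigma> x = x}"

text \<open>
  The action on the residue field of the algebraic closure is the m-th power map.  (Together with
  the ultrametric inequality the condition implies that \<open>\<sigma>\<close> preserves the ring of integers.)
\<close>

definition acts_as_power :: "('a::field_char_0 \<Rightarrow> real) \<Rightarrow> nat \<Rightarrow> ('a \<Rightarrow> 'a) \<Rightarrow> bool"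
  where "acts_as_power v m \<sigma> \<longleftrightarrow> (\<forall>x. v x \<le> 1 \<longrightarrow> v (\<sigma> x - x ^ m) < 1)"

definition inertia :: "('a::field_char_0 \<Rightarrow> real) \<Rightarrow> 'a set \<Rightarrow> ('a \<Rightarrow> 'a) set"
  where "inertia v F = {\<sigma> \<in> abs_galois F. acts_as_power v 1 \<sigma>}"

text \<open>
  The Weil group consists of the automorphisms that act on the residue field as an integral power,
  positive or negative, of \<open>x \<mapsto> x ^ q\<close>.
\<close>

definition weil_group :: "('a::field_char_0 \<Rightarrow> real) \<Rightarrow> 'a set \<Rightarrow> ('a \<Rightarrow> 'a) monoid"
  where "weil_group v F =
    \<lparr>carrier = {\<sigma> \<in> abs_galois F. \<exists>n. acts_as_power v (residue_card v F ^ n) \<sigma> \<or>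
                  acts_as_power v (residue_card v F ^ n) (inv_into UNIV \<sigma>)},
     monoid.mult = (\<circ>), one = id\<rparr>"

text \<open>
  Frobenius elements are geometric, that is, their inverses induce \<open>x \<mapsto> x ^ q\<close>.  This is the
  convention under which \<open>\<omega> \<Phi> = 1 / q\<close> is compatible with
  \<open>t (g \<tau> g\<^sup>-\<^sup>1) = \<omega> g * t \<tau>\<close> on inertia.
\<close>

definition frobenius_element :: "('a::field_char_0 \<Rightarrow> real) \<Rightarrow> 'a set \<Rightarrow> ('a \<Rightarrow> 'a) \<Rightarrow> bool"
  where "frobenius_element v F \<Phi> \<longleftrightarrow>
    \<Phi> \<in> carrier (weil_group v F) \<and> acts_as_power v (residue_card v F) (inv_into UNIV \<Phi>)"

text \<open>The Krull topology is the topology of pointwise convergence for the discrete topology.\<close>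

definition inertia_topology :: "('a::field_char_0 \<Rightarrow> real) \<Rightarrow> 'a set \<Rightarrow> ('a \<Rightarrow> 'a) topology"
  where "inertia_topology v F =
    subtopology (product_topology (\<lambda>_. discrete_topology UNIV) UNIV) (inertia v F)"

text \<open>The topology on the Weil group for which the inertia group is an open subgroup.\<close>

definition weil_topology :: "('a::field_char_0 \<Rightarrow> real) \<Rightarrow> 'a set \<Rightarrow> ('a \<Rightarrow> 'a) topology"
  where "weil_topology v F = topology_generated_by
    {(\<lambda>\<tau>. \<sigma> \<circ> \<tau>) ` V |\<sigma> V. \<sigma> \<in> carrier (weil_group v F) \<and> openin (inertia_topology v F) V}"


section \<open>Matrices and representations\<close>

definition matrix_monoid :: "('r, 'm) ring_scheme \<Rightarrow> ('r^'n^'n) monoid"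
  where "matrix_monoid R =
    \<lparr>carrier = {A. \<forall>i j. A $ i $ j \<in> carrier R},
     monoid.mult = (\<lambda>A B. \<chi> i j. \<Oplus>\<^bsub>R\<^esub>k\<in>UNIV. A $ i $ k \<otimes>\<^bsub>R\<^esub> B $ k $ j),
     one = (\<chi> i j. if i = j then \<one>\<^bsub>R\<^esub> else \<zero>\<^bsub>R\<^esub>)\<rparr>"

definition GL :: "('r, 'm) ring_scheme \<Rightarrow> ('r^'n^'n) monoid"
  where "GL R = units_of (matrix_monoid R)"

definition map_mat :: "('r \<Rightarrow> 's) \<Rightarrow> 'r^'n^'n \<Rightarrow> 's^'n^'n"
  where "map_mat f A = (\<chi> i j. f (A $ i $ j))"

abbreviation mat22 :: "'r::zero \<Rightarrow> 'r \<Rightarrow> 'r \<Rightarrow> 'r \<Rightarrow> 'r^2^2"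
  where "mat22 a b c d \<equiv> vector [vector [a, b], vector [c, d]]"

lemma mult_matrix_monoid_field_of_type:
  "monoid.mult (matrix_monoid (field_of_type :: 'r::field_char_0 ring))
     = ((**) :: 'r^'n^'n \<Rightarrow> 'r^'n^'n \<Rightarrow> 'r^'n^'n)"
proof -
  interpret ring "field_of_type :: 'r ring" by (rule ring_from_type_algebra)
  have "(\<Oplus>\<^bsub>(field_of_type :: 'r ring)\<^esub>k\<in>A. f k) = (\<Sum>k\<in>A. f k)"
    if "finite A" for A :: "'n set" and f :: "'n \<Rightarrow> 'r"
    using that
  proof (induction A)
    case empty
    have "\<zero>\<^bsub>(field_of_type :: 'r ring)\<^esub> = 0" by (simp add: ring_of_type_algebra_def)
    then show ?case by (simp only: finsum_empty sum.empty)
  next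
    case (insert x A)
    then have "(\<Oplus>\<^bsub>(field_of_type :: 'r ring)\<^esub>k\<in>insert x A. f k)
        = f x \<oplus>\<^bsub>field_of_type\<^esub> (\<Oplus>\<^bsub>(field_of_type :: 'r ring)\<^esub>k\<in>A. f k)"
      by (intro finsum_insert) (auto simp: ring_of_type_algebra_def)
    with insert show ?case by (simp add: ring_of_type_algebra_def)
  qed
  then show ?thesis
    by (auto simp: matrix_monoid_def matrix_matrix_mult_def ring_of_type_algebra_def fun_eq_iff)
qed

lemma one_matrix_monoid_field_of_type:
  "one (matrix_monoid (field_of_type :: 'r::field_char_0 ring)) = (mat 1 :: 'r^'n^'n)"
  by (simp add: matrix_monoid_def mat_def ring_of_type_algebra_def cong: if_cong)

definition isomorphic_reps :: "'g monoid \<Rightarrow> ('r, 'm) ring_scheme \<Rightarrow>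
    ('g \<Rightarrow> 'r^'n^'n) \<Rightarrow> ('g \<Rightarrow> 'r^'n^'n) \<Rightarrow> bool"
  where "isomorphic_reps G R \<rho> \<sigma> \<longleftrightarrow> (\<exists>P \<in> carrier (GL R). \<forall>g \<in> carrier G.
    P \<otimes>\<^bsub>GL R\<^esub> \<rho> g = \<sigma> g \<otimes>\<^bsub>GL R\<^esub> P)"

definition weil_rep :: "('a::field_char_0 \<Rightarrow> real) \<Rightarrow> 'a set \<Rightarrow> ('b::field_char_0 \<Rightarrow> real) \<Rightarrow>
    (('a \<Rightarrow> 'a) \<Rightarrow> 'b^'n^'n) \<Rightarrow> bool"
  where "weil_rep v F w \<rho> \<longleftrightarrow> \<rho> \<in> hom (weil_group v F) (GL field_of_type) \<and>
    (\<forall>i j. continuous_map (weil_topology v F) (val_topology w) (\<lambda>g. \<rho> g $ i $ j))"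

definition weil_character :: "('a::field_char_0 \<Rightarrow> real) \<Rightarrow> 'a set \<Rightarrow>
    ('b::field_char_0 \<Rightarrow> real) \<Rightarrow> (('a \<Rightarrow> 'a) \<Rightarrow> 'b) \<Rightarrow> bool"
  where "weil_character v F w \<psi> \<longleftrightarrow> \<psi> \<in> hom (weil_group v F) (units_of field_of_type) \<and>
    continuous_map (weil_topology v F) (val_topology w) \<psi>"


section \<open>Weil--Deligne representations\<close>

definition mat_pow :: "'r::semiring_1^'n^'n \<Rightarrow> nat \<Rightarrow> 'r^'n^'n"
  where "mat_pow A i = (((**) A) ^^ i) (mat 1)"

definition nilpotent_mat :: "'r::semiring_1^'n^'n \<Rightarrow> bool"
  where "nilpotent_mat A \<longleftrightarrow> (\<exists>i. mat_pow A i = 0)"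

text \<open>The n-th power of a nilpotent n by n matrix is 0, so the exponential series stops there.\<close>

definition nilpotent_exp :: "'r::field_char_0^'n^'n \<Rightarrow> 'r^'n^'n"
  where "nilpotent_exp A = (\<Sum>i<CARD('n). mat (1 / fact i) ** mat_pow A i)"

definition weil_deligne :: "('a::field_char_0 \<Rightarrow> real) \<Rightarrow> 'a set \<Rightarrow> ('a \<Rightarrow> 'a) \<Rightarrow>
    (('a \<Rightarrow> 'a) \<Rightarrow> 'b::field_char_0) \<Rightarrow> (('a \<Rightarrow> 'a) \<Rightarrow> 'b^'n^'n) \<Rightarrow>
    (('a \<Rightarrow> 'a) \<Rightarrow> 'b^'n^'n) \<Rightarrow> 'b^'n^'n \<Rightarrow> bool"
  where "weil_deligne v F \<Phi> t \<rho> r N \<longleftrightarrow>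
    nilpotent_mat N \<and>
    (\<exists>H. subgroup H (weil_group v F) \<and> openin (inertia_topology v F) H \<and>
       (\<forall>\<tau>\<in>H. \<rho> \<tau> = nilpotent_exp (mat (t \<tau>) ** N))) \<and>
    (\<forall>(k::int) \<tau>. \<tau> \<in> inertia v F \<longrightarrow>
       r (\<Phi> [^]\<^bsub>weil_group v F\<^esub> k \<otimes>\<^bsub>weil_group v F\<^esub> \<tau>) =
         \<rho> (\<Phi> [^]\<^bsub>weil_group v F\<^esub> k \<otimes>\<^bsub>weil_group v F\<^esub> \<tau>) ** nilpotent_exp (mat (- t \<tau>) ** N))"

definition isomorphic_wd :: "'g monoid \<Rightarrow> ('g \<Rightarrow> 'b::field^'n^'n) \<times> ('b^'n^'n) \<Rightarrow>
    ('g \<Rightarrow> 'b^'n^'n) \<times> ('b^'n^'n) \<Rightarrow> bool"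
  where "isomorphic_wd G = (\<lambda>(r, N) (r', N'). \<exists>P. invertible P \<and>
    (\<forall>g \<in> carrier G. P ** r g = r' g ** P) \<and> P ** N = N' ** P)"

text \<open>
  \<open>\<rho>\<close> is a principal series with Weil--Deligne representation \<open>\<psi>1 \<oplus> \<psi>2\<close>, respectively a special
  representation with Weil--Deligne representation \<open>\<psi>\<omega> \<oplus> \<psi>\<close>.
\<close>

definition principal_series :: "('a::field_char_0 \<Rightarrow> real) \<Rightarrow> 'a set \<Rightarrow> ('a \<Rightarrow> 'a) \<Rightarrow>
    (('a \<Rightarrow> 'a) \<Rightarrow> 'b::field_char_0) \<Rightarrow> ('b \<Rightarrow> real) \<Rightarrow> (('a \<Rightarrow> 'a) \<Rightarrow> 'b^2^2) \<Rightarrow>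
    (('a \<Rightarrow> 'a) \<Rightarrow> 'b) \<Rightarrow> (('a \<Rightarrow> 'a) \<Rightarrow> 'b) \<Rightarrow> bool"
  where "principal_series v F \<Phi> t w \<rho> \<psi>1 \<psi>2 \<longleftrightarrow>
    weil_rep v F w \<rho> \<and> weil_character v F w \<psi>1 \<and> weil_character v F w \<psi>2 \<and>
    (\<exists>r N. weil_deligne v F \<Phi> t \<rho> r N \<and>
       isomorphic_wd (weil_group v F) (r, N) (\<lambda>g. mat22 (\<psi>1 g) 0 0 (\<psi>2 g), 0))"

definition special_rep :: "('a::field_char_0 \<Rightarrow> real) \<Rightarrow> 'a set \<Rightarrow> ('a \<Rightarrow> 'a) \<Rightarrow>
    (('a \<Rightarrow> 'a) \<Rightarrow> 'b::field_char_0) \<Rightarrow> ('b \<Rightarrow> real) \<Rightarrow> (('a \<Rightarrow> 'a) \<Rightarrow> 'b) \<Rightarrow>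
    (('a \<Rightarrow> 'a) \<Rightarrow> 'b^2^2) \<Rightarrow> (('a \<Rightarrow> 'a) \<Rightarrow> 'b) \<Rightarrow> bool"
  where "special_rep v F \<Phi> t w \<omega> \<rho> \<psi> \<longleftrightarrow>
    weil_rep v F w \<rho> \<and> weil_character v F w \<psi> \<and>
    (\<exists>r N. weil_deligne v F \<Phi> t \<rho> r N \<and>
       isomorphic_wd (weil_group v F) (r, N)
         (\<lambda>g. mat22 (\<psi> g * \<omega> g) 0 0 (\<psi> g), mat22 0 1 0 0))"

end

theory Submission
  imports Defs
begin

text \<open>
  Let \<open>P\<close> be a matrix that intertwines the two reductions, and let \<open>\<tau>\<close> be an element of inertia with
  \<open>t \<tau> = 1\<close>. The upper right entry of \<open>\<rho>2 \<tau>\<close> is a unit, while both diagonal entries are \<open>\<psi> \<tau>\<close>. This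
  forces the lower left entry of \<open>P\<close> to vanish, so that the diagonal entries of \<open>P\<close> are units and
  the reductions of the diagonal characters agree in order. At \<open>\<tau>\<close> the upper right entry
  \<open>b1 / d1 * (\<psi>2 \<tau> - \<psi>1 \<tau>)\<close> of \<open>\<rho>1 \<tau>\<close> must then be a unit although \<open>\<psi>1 \<tau>\<close> and \<open>\<psi>2 \<tau>\<close> are congruent. Hence
  \<open>b1 / d1\<close> is not integral, and the integrality of \<open>\<rho>1\<close> makes \<open>\<psi>1\<close> and \<open>\<psi>2\<close> congruent everywhere.
  Thus \<open>\<omega>\<close> is trivial modulo the maximal ideal, that is, \<open>q\<close> is congruent to 1, and the upper right
  entries are related by the ratio \<open>x\<close> of the diagonal entries of \<open>P\<close>. Conversely, the diagonal
  matrix with entries \<open>x\<close> and 1 intertwines the reductions.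
\<close>

no_notation fps_nth (infixl \<open>$\<close> 75)

section \<open>The Weil group\<close>

lemma abs_galois_iff:
  "\<sigma> \<in> abs_galois F \<longleftrightarrow> bij \<sigma> \<and> (\<forall>x y. \<sigma> (x + y) = \<sigma> x + \<sigma> y) \<and> (\<forall>x y. \<sigma> (x * y) = \<sigma> x * \<sigma> y)
     \<and> \<sigma> 1 = 1 \<and> (\<forall>x\<in>F. \<sigma> x = x)"
  by (auto simp: abs_galois_def ring_iso_def ring_hom_def ring_of_type_algebra_def)

lemma abs_galois_inv:
  assumes "\<sigma> \<in> abs_galois F"
  shows "inv_into UNIV \<sigma> \<in> abs_galois F"
proof -
  have b: "bij \<sigma>" and a: "\<And>x y. \<sigma> (x + y) = \<sigma> x + \<sigma> y" and m: "\<And>x y. \<sigma> (x * y) = \<sigma> x * \<sigma> y"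
    and o: "\<sigma> 1 = 1" and f: "\<And>x. x \<in> F \<Longrightarrow> \<sigma> x = x"
    using assms by (auto simp: abs_galois_iff)
  have r: "\<sigma> (inv_into UNIV \<sigma> x) = x" for x
    using b by (simp add: bij_is_surj surj_f_inv_f)
  have e: "inv_into UNIV \<sigma> x = y \<longleftrightarrow> x = \<sigma> y" for x y
    using b r by (metis bij_inv_eq_iff)
  show ?thesis
    using b by (auto simp: abs_galois_iff bij_imp_bij_inv e a m o f r)
qed

lemma abs_galois_comp:
  "\<sigma> \<in> abs_galois F \<Longrightarrow> \<tau> \<in> abs_galois F \<Longrightarrow> \<sigma> \<circ> \<tau> \<in> abs_galois F"
  by (auto simp: abs_galois_iff bij_comp)

lemma abs_galois_id: "id \<in> abs_galois F"
  by (auto simp: abs_galois_iff)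

lemma abs_galois_diff: "\<sigma> \<in> abs_galois F \<Longrightarrow> \<sigma> (x - y) = \<sigma> x - \<sigma> y"
  unfolding abs_galois_iff by (metis add_diff_cancel_right' diff_add_cancel)

section \<open>Ultrametric estimates, congruences, and the degree of an automorphism on
  residues\<close>

context padic_closure
begin

lemma v_0 [simp]: "v 0 = 0"
  by (simp add: eq_0_iff)

lemma v_1 [simp]: "v 1 = 1"
  using mult[of 1 1] eq_0_iff[of 1] by simp

lemma v_minus [simp]: "v (- x) = v x"
proof -
  have "v (-1) * v (-1) = 1" using mult[of "-1" "-1"] by simp
  then have "v (-1) = 1"
    using nonneg[of "-1"] by (metis abs_of_nonneg abs_mult_self_eq mult_eq_0_iff real_sqrt_abs2 real_sqrt_one)
  then show ?thesis using mult[of "-1" x] by simp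
qed

lemma v_minus_commute: "v (x - y) = v (y - x)"
  by (metis minus_diff_eq v_minus)

lemma v_power [simp]: "v (x ^ n) = v x ^ n"
  by (induction n) (auto simp: mult)

lemma v_inverse [simp]: "v (inverse x) = inverse (v x)"
  using mult[of x "inverse x"] by (cases "x = 0") (auto simp: field_simps eq_0_iff)

lemma v_add_le: "v x \<le> c \<Longrightarrow> v y \<le> c \<Longrightarrow> v (x + y) \<le> c"
  using ultrametric[of x y] by simp

lemma v_add_less: "v x < c \<Longrightarrow> v y < c \<Longrightarrow> v (x + y) < c"
  using ultrametric[of x y] by simp

lemma v_diff_le: "v x \<le> c \<Longrightarrow> v y \<le> c \<Longrightarrow> v (x - y) \<le> c"
  using v_add_le[of x c "-y"] by simp

lemma v_diff_less: "v x < c \<Longrightarrow> v y < c \<Longrightarrow> v (x - y) < c"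
  using v_add_less[of x c "-y"] by simp

lemma v_mult_le: "v x \<le> 1 \<Longrightarrow> v y \<le> 1 \<Longrightarrow> v (x * y) \<le> 1"
  by (simp add: mult mult_le_one nonneg)

lemma v_mult_less: "v x \<le> 1 \<Longrightarrow> v y < 1 \<Longrightarrow> v (x * y) < 1"
  using mult_left_le_one_le[of "v y" "v x"] nonneg[of x] nonneg[of y] by (simp add: mult)

text \<open>Congruence modulo the maximal ideal of the valuation ring of the whole field. On a
  subfield it restricts to congruence modulo that subfield's own maximal ideal, so one relation
  serves both for the Galois action and for matrix entries.\<close>

definition res_eq :: "'a \<Rightarrow> 'a \<Rightarrow> bool" (infix "\<asymp>" 50)
  where "x \<asymp> y \<longleftrightarrow> v (x - y) < 1"

lemma res_eq_refl [simp]: "x \<asymp> x"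
  by (simp add: res_eq_def)

lemma res_eq_sym: "x \<asymp> y \<longleftrightarrow> y \<asymp> x"
  by (simp add: res_eq_def v_minus_commute)

lemma res_eq_trans [trans]: "x \<asymp> y \<Longrightarrow> y \<asymp> z \<Longrightarrow> x \<asymp> z"
  using v_add_less[of "x - y" 1 "y - z"] by (simp add: res_eq_def)

lemma res_eq_integral: "x \<asymp> y \<Longrightarrow> v x \<le> 1 \<longleftrightarrow> v y \<le> 1"
  using v_add_le[of "x - y" 1 y] v_diff_le[of x 1 "x - y"] by (auto simp: res_eq_def)

lemma res_eq_mult:
  assumes "x \<asymp> y" "x' \<asymp> y'" "v y \<le> 1" "v x' \<le> 1"
  shows "x * x' \<asymp> y * y'"
proof -
  \<comment> \<open>This sum is \<open>x * x' - y * y'\<close>; its coefficients are exactly the two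
    elements assumed integral.\<close>
  have "v (x' * (x - y) + y * (x' - y')) < 1"
    using assms by (intro v_add_less v_mult_less) (auto simp: res_eq_def)
  then show ?thesis by (simp add: res_eq_def algebra_simps)
qed

lemma res_eq_power:
  assumes "x \<asymp> y" "v x \<le> 1"
  shows "x ^ n \<asymp> y ^ n"
proof (induction n)
  case (Suc n)
  then show ?case
    using assms res_eq_integral[OF assms(1)] by (auto intro!: res_eq_mult simp: power_le_one nonneg)
qed simp

text \<open>
  An element of the Weil group acts on the residue field as the \<open>q ^ k\<close>-th power map for an integer
  \<open>k\<close>; a fraction \<open>q ^ m / q ^ n\<close> avoids case distinctions on the sign.
\<close>

definition frob_degree :: "nat \<Rightarrow> ('a \<Rightarrow> 'a) \<Rightarrow> int \<Rightarrow> bool"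
  where "frob_degree q \<sigma> k \<longleftrightarrow> (\<forall>x. v (\<sigma> x) \<le> 1 \<longleftrightarrow> v x \<le> 1) \<and>
    (\<exists>m n. k = int m - int n \<and> (\<forall>x. v x \<le> 1 \<longrightarrow> \<sigma> x ^ (q ^ n) \<asymp> x ^ (q ^ m)))"

lemma frob_degree_id: "frob_degree q id 0"
  unfolding frob_degree_def by (intro conjI exI[of _ 0]) auto

lemma frob_degree_comp:
  assumes "frob_degree q \<sigma> k" "frob_degree q \<tau> j"
  shows "frob_degree q (\<sigma> \<circ> \<tau>) (k + j)"
proof -
  obtain m n where s: "\<And>x. v (\<sigma> x) \<le> 1 \<longleftrightarrow> v x \<le> 1" "k = int m - int n"
    "\<And>x. v x \<le> 1 \<Longrightarrow> \<sigma> x ^ (q ^ n) \<asymp> x ^ (q ^ m)"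
    using assms(1) unfolding frob_degree_def by blast
  obtain m' n' where t: "\<And>x. v (\<tau> x) \<le> 1 \<longleftrightarrow> v x \<le> 1" "j = int m' - int n'"
    "\<And>x. v x \<le> 1 \<Longrightarrow> \<tau> x ^ (q ^ n') \<asymp> x ^ (q ^ m')"
    using assms(2) unfolding frob_degree_def by blast
  \<comment> \<open>The relation for \<open>\<sigma>\<close> at \<open>\<tau> x\<close> is raised to
    the power \<open>q ^ n'\<close> and the relation for \<open>\<tau>\<close> to the power
    \<open>q ^ m\<close>; they meet because power maps commute.\<close>
  have "\<sigma> (\<tau> x) ^ (q ^ (n + n')) \<asymp> x ^ (q ^ (m + m'))" if x: "v x \<le> 1" for x
  proof -
    have "\<sigma> (\<tau> x) ^ (q ^ (n + n')) = (\<sigma> (\<tau> x) ^ (q ^ n)) ^ (q ^ n')"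
      by (simp add: power_add power_mult)
    also have "\<dots> \<asymp> (\<tau> x ^ (q ^ m)) ^ (q ^ n')"
      using s t x by (intro res_eq_power) (auto simp: power_le_one nonneg)
    also have "(\<tau> x ^ (q ^ m)) ^ (q ^ n') = (\<tau> x ^ (q ^ n')) ^ (q ^ m)"
      by (simp add: mult.commute flip: power_mult)
    also have "\<dots> \<asymp> (x ^ (q ^ m')) ^ (q ^ m)"
      using s t x by (intro res_eq_power) (auto simp: power_le_one nonneg)
    also have "\<dots> = x ^ (q ^ (m + m'))"
      by (simp add: power_add mult.commute flip: power_mult)
    finally show ?thesis .
  qed
  then show ?thesis
    unfolding frob_degree_def using s(1,2) t(1,2)
    by (intro conjI exI[of _ "m + m'"] exI[of _ "n + n'"]) auto
qed

text \<open>Evaluating the relation for \<open>\<sigma>\<close> at the preimage of \<open>x\<close>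
  and reading it backwards swaps numerator and denominator.\<close>

lemma frob_degree_inv:
  assumes "frob_degree q \<sigma> k" "bij \<sigma>"
  shows "frob_degree q (inv_into UNIV \<sigma>) (- k)"
proof -
  obtain m n where s: "\<And>x. v (\<sigma> x) \<le> 1 \<longleftrightarrow> v x \<le> 1" "k = int m - int n"
    "\<And>x. v x \<le> 1 \<Longrightarrow> \<sigma> x ^ (q ^ n) \<asymp> x ^ (q ^ m)"
    using assms(1) unfolding frob_degree_def by blast
  have r: "\<sigma> (inv_into UNIV \<sigma> x) = x" for x
    using assms(2) by (simp add: bij_is_surj surj_f_inv_f)
  show ?thesis
    unfolding frob_degree_def using s(1)[of "inv_into UNIV \<sigma> _"] s(2) s(3)[of "inv_into UNIV \<sigma> _"] r
    by (intro conjI exI[of _ m] exI[of _ n]) (auto simp: res_eq_sym)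
qed

text \<open>Since \<open>acts_as_power\<close> constrains only integral arguments, the forward
  implication passes to inverses: if \<open>x\<close> is not integral, then \<open>inverse x\<close>
  is in the maximal ideal, and so is its image because \<open>M > 0\<close>. An integral
  \<open>\<sigma> x\<close> would then put 1 in the maximal ideal.\<close>

lemma acts_as_power_integral_iff:
  assumes "\<sigma> \<in> abs_galois F" "acts_as_power v M \<sigma>" "M > 0"
  shows "v (\<sigma> x) \<le> 1 \<longleftrightarrow> v x \<le> 1"
proof -
  have c: "\<sigma> x \<asymp> x ^ M" if "v x \<le> 1" for x
    using assms that by (simp add: acts_as_power_def res_eq_def)
  show ?thesis
  proof
    assume "v x \<le> 1"
    then show "v (\<sigma> x) \<le> 1"
      using res_eq_integral[OF c] by (simp add: power_le_one nonneg)
  next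
    assume s: "v (\<sigma> x) \<le> 1"
    show "v x \<le> 1"
    proof (rule ccontr)
      assume x: "\<not> v x \<le> 1"
      let ?y = "inverse x"
      from x have nz: "x \<noteq> 0" and y: "v ?y < 1" by (auto simp: inverse_less_1_iff)
      then have "v (\<sigma> ?y - ?y ^ M) < 1" "v (?y ^ M) < 1"
        using c[of ?y] assms(3) nonneg[of x]
        by (auto simp: res_eq_def power_less_one_iff simp del: power_inverse)
      then have "v (\<sigma> ?y) < 1" using v_add_less by fastforce
      then have "v (\<sigma> x * \<sigma> ?y) < 1" using s by (rule v_mult_less[rotated])
      moreover have "\<sigma> x * \<sigma> ?y = 1"
        using assms(1) nz by (metis abs_galois_iff right_inverse)
      ultimately show False by simp
    qed
  qed
qed

lemma acts_as_power_frob_degree: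
  assumes "\<sigma> \<in> abs_galois F" "acts_as_power v (q ^ n) \<sigma>" "q > 0"
  shows "frob_degree q \<sigma> (int n)"
  unfolding frob_degree_def
  using assms acts_as_power_integral_iff[OF assms(1,2)]
  by (intro conjI exI[of _ n] exI[of _ 0]) (auto simp: acts_as_power_def res_eq_def)

end

section \<open>The group structure of the Weil group and its decomposition by powers of a Frobenius
  element\<close>

lemma mult_weil_group [simp]: "\<sigma> \<otimes>\<^bsub>weil_group v F\<^esub> \<tau> = \<sigma> \<circ> \<tau>"
  by (simp add: weil_group_def)

lemma one_weil_group [simp]: "\<one>\<^bsub>weil_group v F\<^esub> = id"
  by (simp add: weil_group_def)

locale weil_frobenius = padic_closure p v for p and v :: "'a::field_char_0 \<Rightarrow> real" +
  fixes F :: "'a set" and \<Phi> :: "'a \<Rightarrow> 'a"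
  assumes frobenius: "frobenius_element v F \<Phi>"
begin

abbreviation "q \<equiv> residue_card v F"
abbreviation "W \<equiv> weil_group v F"

lemma Phi_galois: "\<Phi> \<in> abs_galois F"
  using frobenius by (simp add: frobenius_element_def weil_group_def)

lemma Phi_inv: "v x \<le> 1 \<Longrightarrow> inv_into UNIV \<Phi> x \<asymp> x ^ q"
  using frobenius by (simp add: frobenius_element_def acts_as_power_def res_eq_def)

text \<open>As \<open>card\<close> is 0 on infinite sets, positivity has content. If
  \<open>q\<close> were 0, the inverse of \<open>\<Phi>\<close> would send 0 to an element congruent
  to \<open>0 ^ 0 = 1\<close>, but an automorphism fixes 0.\<close>

lemma q_pos: "q > 0"
  using Phi_inv[of 0] abs_galois_diff[OF abs_galois_inv[OF Phi_galois], of 0 0]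
  by (cases "q = 0") (auto simp: res_eq_def)

text \<open>The automorphism \<open>\<Phi>\<^sup>-\<^sup>1\<close> is injective on the residue field, hence so is the q-th power map.\<close>

lemma res_eq_power_cancel:
  assumes "x ^ (q ^ n) \<asymp> y ^ (q ^ n)" "v x \<le> 1" "v y \<le> 1"
  shows "x \<asymp> y"
  using assms(1)
proof (induction n)
  case (Suc n)
  let ?f = "inv_into UNIV \<Phi>" and ?x = "x ^ (q ^ n)" and ?y = "y ^ (q ^ n)"
  have i: "v ?x \<le> 1" "v ?y \<le> 1" "v (?x - ?y) \<le> 1"
    using assms(2,3) by (auto simp: power_le_one nonneg intro!: v_diff_le)
  have "z ^ (q ^ Suc n) = (z ^ (q ^ n)) ^ q" for z :: 'a
    by (simp only: power_Suc2 power_mult)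
  then have "?f ?x \<asymp> ?x ^ q" "?f ?y \<asymp> ?y ^ q" "?x ^ q \<asymp> ?y ^ q"
    using Phi_inv[OF i(1)] Phi_inv[OF i(2)] Suc.prems by simp_all
  then have "?f ?x \<asymp> ?f ?y" using res_eq_trans res_eq_sym by blast
  \<comment> \<open>Additivity of \<open>?f\<close> turns the congruence of two q-th powers into the
    vanishing of the q-th power of the difference.\<close>
  then have "?f (?x - ?y) \<asymp> 0"
    by (simp add: res_eq_def abs_galois_diff[OF abs_galois_inv[OF Phi_galois]])
  then have "(?x - ?y) ^ q \<asymp> 0"
    using Phi_inv[OF i(3)] res_eq_trans res_eq_sym by blast
  then have "?x \<asymp> ?y"
    using nonneg by (simp add: res_eq_def power_less_one_iff)
  then show ?case using Suc.IH by blast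
qed simp

text \<open>Injectivity of the power map on residues cancels the common factor \<open>q ^ n\<close>
  of the fraction.\<close>

lemma frob_degree_nonneg:
  assumes "frob_degree q \<sigma> (int k)"
  shows "acts_as_power v (q ^ k) \<sigma>"
proof -
  obtain m n where s: "\<And>x. v (\<sigma> x) \<le> 1 \<longleftrightarrow> v x \<le> 1" "int k = int m - int n"
    "\<And>x. v x \<le> 1 \<Longrightarrow> \<sigma> x ^ (q ^ n) \<asymp> x ^ (q ^ m)"
    using assms unfolding frob_degree_def by blast
  then have m: "m = k + n" by simp
  have "\<sigma> x \<asymp> x ^ (q ^ k)" if x: "v x \<le> 1" for x
  proof (rule res_eq_power_cancel[of _ n])
    show "\<sigma> x ^ (q ^ n) \<asymp> (x ^ (q ^ k)) ^ (q ^ n)"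
      using s(3)[OF x] by (simp only: m power_add power_mult)
    show "v (\<sigma> x) \<le> 1" "v (x ^ (q ^ k)) \<le> 1"
      using x s(1) by (simp_all add: power_le_one nonneg)
  qed
  then show ?thesis by (simp add: acts_as_power_def res_eq_def)
qed

text \<open>Replaces the two-sided case distinction in the definition by a single integer degree,
  which is additive; closure under composition and inverses then becomes immediate.\<close>

lemma weil_group_iff:
  "\<sigma> \<in> carrier W \<longleftrightarrow> \<sigma> \<in> abs_galois F \<and> (\<exists>k. frob_degree q \<sigma> k)"
proof (cases "\<sigma> \<in> abs_galois F")
  case True
  let ?\<sigma>' = "inv_into UNIV \<sigma>"
  have b: "bij \<sigma>" "bij ?\<sigma>'" "inv_into UNIV ?\<sigma>' = \<sigma>"
    using True by (auto simp: abs_galois_iff bij_imp_bij_inv inv_inv_eq)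
  have W: "\<sigma> \<in> carrier W \<longleftrightarrow> (\<exists>n. acts_as_power v (q ^ n) \<sigma> \<or> acts_as_power v (q ^ n) ?\<sigma>')"
    using True by (simp add: weil_group_def)
  show ?thesis
  proof
    assume "\<sigma> \<in> carrier W"
    then consider n where "frob_degree q \<sigma> (int n)" | n where "frob_degree q ?\<sigma>' (int n)"
      using W acts_as_power_frob_degree[OF True _ q_pos]
        acts_as_power_frob_degree[OF abs_galois_inv[OF True] _ q_pos] by blast
    then show "\<sigma> \<in> abs_galois F \<and> (\<exists>k. frob_degree q \<sigma> k)"
      using True frob_degree_inv[OF _ b(2)] b(3) by cases (force, metis)
  next
    assume "\<sigma> \<in> abs_galois F \<and> (\<exists>k. frob_degree q \<sigma> k)"
    then obtain k where k: "frob_degree q \<sigma> k" by blast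
    consider n where "k = int n" | n where "- k = int n"
      by (metis int_cases2 minus_minus)
    then show "\<sigma> \<in> carrier W"
    proof cases
      case (1 n)
      then show ?thesis using k frob_degree_nonneg W by blast
    next
      case (2 n)
      then show ?thesis using frob_degree_inv[OF k b(1)] frob_degree_nonneg W by metis
    qed
  qed
qed (simp add: weil_group_def)

lemma inertia_iff: "\<sigma> \<in> inertia v F \<longleftrightarrow> \<sigma> \<in> abs_galois F \<and> frob_degree q \<sigma> 0"
proof -
  have "frob_degree q \<sigma> 0 \<longleftrightarrow> acts_as_power v 1 \<sigma>" if "\<sigma> \<in> abs_galois F"
    using frob_degree_nonneg[of \<sigma> 0] acts_as_power_frob_degree[OF that, of q 0] q_pos by auto
  then show ?thesis by (auto simp: inertia_def)
qed

lemma group_W: "group W"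
proof (rule groupI)
  fix \<sigma> assume "\<sigma> \<in> carrier W"
  then obtain k where k: "\<sigma> \<in> abs_galois F" "frob_degree q \<sigma> k" "bij \<sigma>"
    by (auto simp: weil_group_iff abs_galois_iff)
  then show "\<exists>\<tau>\<in>carrier W. \<tau> \<otimes>\<^bsub>W\<^esub> \<sigma> = \<one>\<^bsub>W\<^esub>"
    using abs_galois_inv[OF k(1)] frob_degree_inv[OF k(2,3)]
    by (intro bexI[of _ "inv_into UNIV \<sigma>"]) (auto simp: weil_group_iff bij_is_inj)
qed (auto simp: weil_group_iff abs_galois_id abs_galois_comp comp_assoc intro: frob_degree_id frob_degree_comp)

sublocale group W
  by (rule group_W)

lemma inv_weil_group:
  assumes "\<sigma> \<in> carrier W"
  shows "inv\<^bsub>W\<^esub> \<sigma> = inv_into UNIV \<sigma>"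
proof -
  have "\<sigma> \<circ> inv\<^bsub>W\<^esub> \<sigma> = id"
    using r_inv[OF assms] by simp
  moreover have "inv_into UNIV \<sigma> \<circ> \<sigma> = id"
    using assms by (auto simp: weil_group_iff abs_galois_iff bij_is_inj)
  ultimately show ?thesis
    by (metis comp_assoc comp_id id_comp)
qed

lemma Phi_W: "\<Phi> \<in> carrier W"
  using frobenius by (simp add: frobenius_element_def)

text \<open>The sign reflects the geometric convention: it is the inverse of \<open>\<Phi>\<close>
  that has degree 1.\<close>

lemma frob_degree_Phi: "frob_degree q \<Phi> (- 1)"
proof -
  have "bij \<Phi>" using Phi_galois by (simp add: abs_galois_iff)
  then have "inv_into UNIV (inv_into UNIV \<Phi>) = \<Phi>" "bij (inv_into UNIV \<Phi>)"
    by (auto simp: inv_inv_eq bij_imp_bij_inv)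
  then show ?thesis
    using acts_as_power_frob_degree[OF abs_galois_inv[OF Phi_galois], of q 1] frobenius q_pos
      frob_degree_inv[of q "inv_into UNIV \<Phi>" 1]
    by (simp add: frobenius_element_def)
qed

lemma frob_degree_Phi_pow: "frob_degree q (\<Phi> [^]\<^bsub>W\<^esub> (k::int)) (- k)"
proof -
  have n: "frob_degree q (\<Phi> [^]\<^bsub>W\<^esub> n) (- int n)" for n :: nat
  proof (induction n)
    case (Suc n)
    have "- int (Suc n) = - int n + - 1" by simp
    then show ?case using frob_degree_comp[OF Suc frob_degree_Phi] by (simp only: nat_pow_Suc mult_weil_group)
  qed (simp add: frob_degree_id[unfolded id_def])
  have b: "bij (\<Phi> [^]\<^bsub>W\<^esub> n)" for n :: nat
    using nat_pow_closed[OF Phi_W, of n] by (simp add: weil_group_iff abs_galois_iff)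
  show ?thesis
  proof (cases "k \<ge> 0")
    case True
    then obtain m where "k = int m" using nonneg_int_cases by blast
    then show ?thesis using n[of m] by (simp add: int_pow_int)
  next
    case False
    then obtain m where "k = - int m" by (metis int_cases2 of_nat_0_le_iff)
    then show ?thesis
      using frob_degree_inv[OF n[of m] b] Phi_W
      by (simp add: int_pow_neg int_pow_int inv_weil_group)
  qed
qed

text \<open>Since \<open>\<Phi>\<close> has degree -1, multiplying an element of degree
  \<open>k\<close> by the \<open>k\<close>-th power of \<open>\<Phi>\<close> gives degree 0, that
  is, an inertia element. Formulas stated for these products thus cover the whole group.\<close>

lemma weil_group_eq:
  "carrier W = {\<Phi> [^]\<^bsub>W\<^esub> (k::int) \<otimes>\<^bsub>W\<^esub> \<tau> |k \<tau>. \<tau> \<in> inertia v F}"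
proof (intro equalityI subsetI)
  fix g assume g: "g \<in> carrier W"
  then obtain k where k: "frob_degree q g k" by (auto simp: weil_group_iff)
  let ?\<tau> = "\<Phi> [^]\<^bsub>W\<^esub> k \<otimes>\<^bsub>W\<^esub> g"
  have "?\<tau> \<in> carrier W" using g Phi_W by blast
  then have t: "?\<tau> \<in> inertia v F"
    using frob_degree_comp[OF frob_degree_Phi_pow[of k] k] by (simp add: inertia_iff weil_group_iff)
  have "\<Phi> [^]\<^bsub>W\<^esub> (- k) \<otimes>\<^bsub>W\<^esub> \<Phi> [^]\<^bsub>W\<^esub> k = id"
    using int_pow_mult[OF Phi_W, of "- k" k] by simp
  then have "\<Phi> [^]\<^bsub>W\<^esub> (- k) \<otimes>\<^bsub>W\<^esub> ?\<tau> = g"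
    by (simp flip: comp_assoc)
  with t show "g \<in> {\<Phi> [^]\<^bsub>W\<^esub> (k::int) \<otimes>\<^bsub>W\<^esub> \<tau> |k \<tau>. \<tau> \<in> inertia v F}"
    by (intro CollectI exI[of _ "- k"] exI[of _ ?\<tau>]) simp
next
  fix g assume "g \<in> {\<Phi> [^]\<^bsub>W\<^esub> (k::int) \<otimes>\<^bsub>W\<^esub> \<tau> |k \<tau>. \<tau> \<in> inertia v F}"
  then obtain k :: int and \<tau> where g: "g = \<Phi> [^]\<^bsub>W\<^esub> k \<otimes>\<^bsub>W\<^esub> \<tau>" "\<tau> \<in> inertia v F" by blast
  then have "\<tau> \<in> carrier W" by (auto simp: inertia_iff weil_group_iff)
  with g Phi_W show "g \<in> carrier W" by (simp del: mult_weil_group)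
qed

lemma id_inertia: "id \<in> inertia v F"
  by (simp add: inertia_iff abs_galois_id frob_degree_id)

end

section \<open>Two by two matrices over rings\<close>

lemma UNIV_two: "(UNIV :: 2 set) = {1, 2}"
  using exhaust_2 by auto

lemma matrix_monoid_carrier_iff:
  "A \<in> carrier (matrix_monoid R) \<longleftrightarrow> (\<forall>i j. A $ i $ j \<in> carrier R)"
  by (simp add: matrix_monoid_def)

lemma (in ring) matrix_monoid_mult_2:
  fixes A B :: "'a^2^2"
  assumes "A \<in> carrier (matrix_monoid R)" "B \<in> carrier (matrix_monoid R)"
  shows "(A \<otimes>\<^bsub>matrix_monoid R\<^esub> B) $ i $ j = A $ i $ 1 \<otimes> B $ 1 $ j \<oplus> A $ i $ 2 \<otimes> B $ 2 $ j"
proof -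
  have A: "A $ i $ j \<in> carrier R" and B: "B $ i $ j \<in> carrier R" for i j
    using assms by (auto simp: matrix_monoid_carrier_iff)
  have "(\<Oplus>k\<in>{1, 2::2}. A $ i $ k \<otimes> B $ k $ j)
      = A $ i $ 1 \<otimes> B $ 1 $ j \<oplus> (\<Oplus>k\<in>{2::2}. A $ i $ k \<otimes> B $ k $ j)"
    using A B by (subst finsum_insert) auto
  also have "(\<Oplus>k\<in>{2::2}. A $ i $ k \<otimes> B $ k $ j) = A $ i $ 2 \<otimes> B $ 2 $ j"
    using A B by (subst finsum_insert) auto
  finally show ?thesis by (simp add: matrix_monoid_def UNIV_two)
qed

lemma matrix_monoid_one_nth: "\<one>\<^bsub>matrix_monoid R\<^esub> $ i $ j = (if i = j then \<one>\<^bsub>R\<^esub> else \<zero>\<^bsub>R\<^esub>)"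
  by (simp add: matrix_monoid_def)

lemma GL_carrierD: "A \<in> carrier (GL R) \<Longrightarrow> A $ i $ j \<in> carrier R"
  by (auto simp: GL_def units_of_def Units_def matrix_monoid_carrier_iff)

text \<open>The unknown lower left entry of the inverse \<open>B\<close> is avoided by using entry
  (1,1) of \<open>B\<close> times \<open>A\<close> and entry (2,2) of \<open>A\<close> times
  \<open>B\<close>; commutativity makes the one-sided inverses two-sided.\<close>

lemma (in cring) GL_2_upper_triangular:
  fixes A :: "'a^2^2"
  assumes A: "A \<in> carrier (GL R)" and z: "A $ 2 $ 1 = \<zero>"
  shows "A $ 1 $ 1 \<in> Units R" "A $ 2 $ 2 \<in> Units R"
proof -
  obtain B where B: "A \<in> carrier (matrix_monoid R)" "B \<in> carrier (matrix_monoid R)"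
      "B \<otimes>\<^bsub>matrix_monoid R\<^esub> A = \<one>\<^bsub>matrix_monoid R\<^esub>" "A \<otimes>\<^bsub>matrix_monoid R\<^esub> B = \<one>\<^bsub>matrix_monoid R\<^esub>"
    using A by (auto simp: GL_def units_of_def Units_def)
  then have c: "A $ i $ j \<in> carrier R" "B $ i $ j \<in> carrier R" for i j
    by (auto simp: matrix_monoid_carrier_iff)
  have "B $ 1 $ 1 \<otimes> A $ 1 $ 1 = \<one>"
    using matrix_monoid_mult_2[OF B(2,1), of 1 1] B(3) z c by (simp add: matrix_monoid_one_nth)
  then show "A $ 1 $ 1 \<in> Units R"
    using c by (auto simp: Units_def m_comm intro!: bexI[of _ "B $ 1 $ 1"])
  have "A $ 2 $ 2 \<otimes> B $ 2 $ 2 = \<one>"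
    using matrix_monoid_mult_2[OF B(1,2), of 2 2] B(4) z c by (simp add: matrix_monoid_one_nth)
  then show "A $ 2 $ 2 \<in> Units R"
    using c by (auto simp: Units_def m_comm intro!: bexI[of _ "B $ 2 $ 2"])
qed

text \<open>Provides the intertwining matrix for the converse direction; its inverse is the diagonal
  matrix with entries \<open>inv x\<close> and 1.\<close>

lemma (in ring) GL_2_diagonal:
  assumes "x \<in> Units R"
  shows "(\<chi> i j. if i = j then if i = 1 then x else \<one> else \<zero> :: 'a^2^2) \<in> carrier (GL R)"
    (is "?D x \<in> _")
proof -
  have D: "?D y \<in> carrier (matrix_monoid R)" if "y \<in> carrier R" for y
    using that by (simp add: matrix_monoid_carrier_iff)
  have M: "?D y \<otimes>\<^bsub>matrix_monoid R\<^esub> ?D z = \<one>\<^bsub>matrix_monoid R\<^esub>"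
    if "y \<in> carrier R" "z \<in> carrier R" "y \<otimes> z = \<one>" for y z
    using that by (simp add: vec_eq_iff forall_2 matrix_monoid_mult_2[OF D D] matrix_monoid_one_nth)
  have x: "x \<in> carrier R" "inv x \<in> carrier R" using assms by auto
  then have "?D (inv x) \<otimes>\<^bsub>matrix_monoid R\<^esub> ?D x = \<one>\<^bsub>matrix_monoid R\<^esub>"
    "?D x \<otimes>\<^bsub>matrix_monoid R\<^esub> ?D (inv x) = \<one>\<^bsub>matrix_monoid R\<^esub>"
    using assms by (auto intro!: M)
  then show ?thesis
    using D[OF x(1)] D[OF x(2)] unfolding GL_def units_of_def Units_def by auto
qed

section \<open>Congruences and residue fields\<close>

context padic_closure
begin

text \<open>Ensures that 1 is an l-adic integer, so that surjectivity of \<open>t\<close> yields an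
  inertia element with value 1.\<close>

lemma Rats_padics: "\<rat> \<subseteq> padics v"
proof -
  have "v (x - z) \<le> v (x - y) + v (y - z)" for x y z
    using ultrametric[of "x - y" "y - z"] nonneg[of "x - y"] nonneg[of "y - z"] by simp
  then interpret Metric_space UNIV "\<lambda>x y. v (x - y)"
    by unfold_locales (auto simp: nonneg eq_0_iff intro: v_minus_commute)
  show ?thesis
    unfolding padics_def val_topology_def by (rule closure_of_subset) simp
qed

text \<open>By the normalisation on integers, the absolute value of a nonzero integer drops below 1
  exactly when its multiplicity at \<open>p\<close> is positive.\<close>

lemma res_eq_of_int_iff: "of_int m \<asymp> of_int n \<longleftrightarrow> [m = n] (mod int p)"
proof (cases "m = n")
  case False
  have "p > 1" using prime by (rule prime_gt_1_nat)
  have "of_int m \<asymp> of_int n \<longleftrightarrow> 1 / real p ^ multiplicity (int p) (m - n) < 1"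
    using of_int[of "m - n"] False by (simp add: res_eq_def)
  also have "\<dots> \<longleftrightarrow> multiplicity (int p) (m - n) > 0"
    using \<open>p > 1\<close> by (cases "multiplicity (int p) (m - n)") (auto simp: divide_simps simp flip: power_Suc)
  also have "\<dots> \<longleftrightarrow> int p dvd m - n"
    using False \<open>p > 1\<close> by (subst multiplicity_gt_zero_iff) auto
  finally show ?thesis by (simp add: cong_iff_dvd_diff)
qed simp

lemma res_eq_inverse_iff: "inverse x \<asymp> 1 \<longleftrightarrow> x \<asymp> 1"
proof -
  have *: "inverse x \<asymp> 1" if "x \<asymp> 1" for x
  proof -
    \<comment> \<open>If \<open>x\<close> lay in the maximal ideal, so would
      \<open>(x - 1) - x = -1\<close>.\<close>
    have "v x = 1"
      using that v_add_less[of "x - 1" 1 "- x"] res_eq_integral[OF that] by (force simp: res_eq_def)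
    moreover from this have "x \<noteq> 0" by auto
    then have "inverse x - 1 = inverse x * (1 - x)"
      by (simp add: algebra_simps)
    ultimately show ?thesis
      using that by (simp add: res_eq_def mult v_minus_commute)
  qed
  from *[of x] *[of "inverse x"] show ?thesis by auto
qed

text \<open>Propagates the single congruence of \<open>q\<close> with 1 to all values of \<omega>,
  which are integral powers of \<open>q\<close>.\<close>

lemma res_eq_powi: "x \<asymp> 1 \<Longrightarrow> x powi k \<asymp> 1"
  using res_eq_power[of x 1] res_eq_power[of "inverse x" 1] res_eq_inverse_iff[of x]
    res_eq_integral[of x 1] res_eq_integral[of "inverse x" 1]
  by (auto simp: power_int_def)

end

section \<open>The valuation ring of a subfield, its residue field, and the reduction of
  matrices\<close>

locale valued_subfield = padic_closure p v for p and v :: "'a::field_char_0 \<Rightarrow> real" +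
  fixes K :: "'a set"
  assumes subfield: "subfield K field_of_type"
begin

abbreviation "\<O> \<equiv> int_ring v K"

lemma K_closed:
  "0 \<in> K" "1 \<in> K" "x \<in> K \<Longrightarrow> y \<in> K \<Longrightarrow> x + y \<in> K" "x \<in> K \<Longrightarrow> y \<in> K \<Longrightarrow> x * y \<in> K"
  "x \<in> K \<Longrightarrow> - x \<in> K" "x \<in> K \<Longrightarrow> inverse x \<in> K"
proof -
  interpret R: ring "field_of_type :: 'a ring" by (rule ring_from_type_algebra)
  interpret S: subfield K "field_of_type :: 'a ring" by (rule subfield)
  note S = subfieldE[OF subfield]
  have ops: "\<And>x y. x \<otimes>\<^bsub>(field_of_type :: 'a ring)\<^esub> y = x * y" "\<And>x y. x \<oplus>\<^bsub>(field_of_type :: 'a ring)\<^esub> y = x + y"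
    "\<one>\<^bsub>(field_of_type :: 'a ring)\<^esub> = 1" "\<zero>\<^bsub>(field_of_type :: 'a ring)\<^esub> = 0"
    by (simp_all add: ring_of_type_algebra_def)
  show 0: "0 \<in> K" and "1 \<in> K" and "x \<in> K \<Longrightarrow> y \<in> K \<Longrightarrow> x + y \<in> K" "x \<in> K \<Longrightarrow> y \<in> K \<Longrightarrow> x * y \<in> K"
    using subringE(2,3,6,7)[OF S(1)] by (simp_all add: ops)
  show "- x \<in> K" if "x \<in> K"
  proof -
    have "\<ominus>\<^bsub>field_of_type\<^esub> x = - x"
      by (rule R.minus_equality) (auto simp: ring_of_type_algebra_def)
    with subringE(5)[OF S(1) that] show ?thesis by simp
  qed
  show "inverse x \<in> K" if "x \<in> K"
  proof (cases "x = 0")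
    case False
    then have "x \<in> Units (field_of_type\<lparr>carrier := K\<rparr>)"
      using that by (simp add: S.subfield_Units ops)
    then obtain y where "y \<in> K" "x * y = 1" by (auto simp: Units_def ops)
    then show ?thesis by (metis inverse_unique)
  qed (simp add: 0)
qed

lemma K_diff: "x \<in> K \<Longrightarrow> y \<in> K \<Longrightarrow> x - y \<in> K"
  using K_closed(3)[of x "- y"] K_closed(5) by simp

lemma int_ring_simps [simp]:
  "x \<in> carrier \<O> \<longleftrightarrow> x \<in> K \<and> v x \<le> 1" "x \<otimes>\<^bsub>\<O>\<^esub> y = x * y" "x \<oplus>\<^bsub>\<O>\<^esub> y = x + y"
  "\<one>\<^bsub>\<O>\<^esub> = 1" "\<zero>\<^bsub>\<O>\<^esub> = 0"
  by (simp_all add: int_ring_def ring_of_type_algebra_def)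

lemma cring_int_ring: "cring \<O>"
proof (rule cringI)
  show "abelian_group \<O>"
  proof (rule abelian_groupI)
    fix x assume "x \<in> carrier \<O>"
    then show "\<exists>y\<in>carrier \<O>. y \<oplus>\<^bsub>\<O>\<^esub> x = \<zero>\<^bsub>\<O>\<^esub>"
      by (intro bexI[of _ "- x"]) (auto simp: K_closed)
  qed (auto simp: K_closed v_add_le)
  show "comm_monoid \<O>"
    by (rule comm_monoidI) (auto simp: K_closed v_mult_le)
qed (auto simp: algebra_simps)

sublocale O: cring \<O>
  by (rule cring_int_ring)

lemma int_ring_minus: "x \<in> carrier \<O> \<Longrightarrow> y \<in> carrier \<O> \<Longrightarrow> x \<ominus>\<^bsub>\<O>\<^esub> y = x - y"
  using O.minus_equality[of "- y" y] by (simp add: a_minus_def K_closed)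

lemma ideal_max_ideal: "ideal (max_ideal v K) \<O>"
proof (rule idealI)
  show "subgroup (max_ideal v K) (add_monoid \<O>)"
  proof (rule O.add.subgroupI)
    show "\<ominus>\<^bsub>\<O>\<^esub> x \<in> max_ideal v K" if "x \<in> max_ideal v K" for x
      using that O.minus_equality[of "- x" x] by (simp add: max_ideal_def K_closed)
  next
    have "0 \<in> max_ideal v K" by (simp add: max_ideal_def K_closed)
    then show "max_ideal v K \<noteq> {}" by blast
  qed (auto simp: max_ideal_def K_closed v_add_less)
  show "x \<otimes>\<^bsub>\<O>\<^esub> a \<in> max_ideal v K" "a \<otimes>\<^bsub>\<O>\<^esub> x \<in> max_ideal v K"
    if "a \<in> max_ideal v K" "x \<in> carrier \<O>" for a x
    using that v_mult_less[of x a] by (simp_all add: max_ideal_def K_closed mult.commute)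
qed (rule O.ring_axioms)

abbreviation "\<kappa> \<equiv> residue_field v K"
abbreviation "res \<equiv> residue v K"

text \<open>Bridge between cosets in the quotient ring and congruences; later arguments can
  calculate with absolute values.\<close>

lemma res_eq_iff: "x \<in> carrier \<O> \<Longrightarrow> y \<in> carrier \<O> \<Longrightarrow> res x = res y \<longleftrightarrow> x \<asymp> y"
  using O.quotient_eq_iff_same_a_r_cos[OF ideal_max_ideal, of x y]
  by (simp add: residue_def res_eq_def int_ring_minus max_ideal_def K_diff del: int_ring_simps)
     (simp add: K_diff)

sublocale \<kappa>: cring \<kappa>
  unfolding residue_field_def using ideal.quotient_is_cring[OF ideal_max_ideal cring_int_ring] .

lemma res_hom: "res \<in> ring_hom \<O> \<kappa>"
  using ideal.rcos_ring_hom[OF ideal_max_ideal] unfolding residue_field_def residue_def[abs_def] .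

lemma res_simps:
  assumes "x \<in> carrier \<O>" "y \<in> carrier \<O>"
  shows "res x \<otimes>\<^bsub>\<kappa>\<^esub> res y = res (x * y)" "res x \<oplus>\<^bsub>\<kappa>\<^esub> res y = res (x + y)"
  using ring_hom_mult[OF res_hom assms] ring_hom_add[OF res_hom assms] by simp_all

lemma res_closed: "x \<in> carrier \<O> \<Longrightarrow> res x \<in> carrier \<kappa>"
  using ring_hom_closed[OF res_hom] .

lemma res_1: "res 1 = \<one>\<^bsub>\<kappa>\<^esub>"
  using ring_hom_one[OF res_hom] by simp

lemma res_0: "res 0 = \<zero>\<^bsub>\<kappa>\<^esub>"
  using ring_hom_zero[OF res_hom O.ring_axioms \<kappa>.ring_axioms] by simp

lemma res_surj: "y \<in> carrier \<kappa> \<Longrightarrow> \<exists>x\<in>carrier \<O>. y = res x"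
  by (auto simp: residue_field_def residue_def FactRing_def A_RCOSETS_def')

lemma Units_int_ring: "x \<in> Units \<O> \<longleftrightarrow> x \<in> K \<and> v x = 1"
proof
  assume "x \<in> Units \<O>"
  then obtain y where "x \<in> K" "v x \<le> 1" "v y \<le> 1" "x * y = 1" by (auto simp: Units_def)
  moreover from this have "v x * v y = 1" by (metis mult v_1)
  ultimately show "x \<in> K \<and> v x = 1"
    using nonneg[of x] nonneg[of y] by (metis mult_left_le order_antisym)
next
  assume "x \<in> K \<and> v x = 1"
  moreover from this have "x \<noteq> 0" by auto
  ultimately show "x \<in> Units \<O>"
    by (auto simp: Units_def K_closed intro!: bexI[of _ "inverse x"])
qed

lemma res_Units_iff:
  assumes "x \<in> carrier \<O>"
  shows "res x \<in> Units \<kappa> \<longleftrightarrow> v x = 1"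
proof
  assume "res x \<in> Units \<kappa>"
  then obtain y where "y \<in> carrier \<kappa>" "res x \<otimes>\<^bsub>\<kappa>\<^esub> y = \<one>\<^bsub>\<kappa>\<^esub>" by (auto simp: Units_def)
  then obtain y where y: "y \<in> carrier \<O>" "res x \<otimes>\<^bsub>\<kappa>\<^esub> res y = \<one>\<^bsub>\<kappa>\<^esub>" using res_surj by blast
  \<comment> \<open>A lift \<open>y\<close> of the inverse residue makes \<open>x * y\<close>
    congruent to 1, hence not in the maximal ideal, which excludes \<open>v x < 1\<close>.\<close>
  then have "x * y \<asymp> 1"
    using assms res_simps(1)[OF assms y(1)] O.m_closed[OF assms y(1)]
    by (subst res_eq_iff[symmetric]) (auto simp: res_1 K_closed)
  then have "\<not> v (x * y) < 1"
    using v_add_less[of "1 - x * y" 1 "x * y"] by (auto simp: res_eq_def v_minus_commute)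
  then show "v x = 1"
    using assms y v_mult_less[of y x] by (force simp: mult.commute)
next
  assume "v x = 1"
  then have "x \<noteq> 0" by auto
  moreover have y: "inverse x \<in> carrier \<O>" using assms \<open>v x = 1\<close> by (simp add: K_closed)
  ultimately have "res x \<otimes>\<^bsub>\<kappa>\<^esub> res (inverse x) = \<one>\<^bsub>\<kappa>\<^esub>"
    using res_simps(1)[OF assms y] by (simp add: res_1)
  then show "res x \<in> Units \<kappa>"
    using res_closed[OF y] res_closed[OF assms] \<kappa>.m_comm[of "res x" "res (inverse x)"]
    unfolding Units_def by auto
qed

lemma map_mat_res_mult:
  fixes A B :: "'a^2^2"
  assumes "A \<in> carrier (matrix_monoid \<O>)" "B \<in> carrier (matrix_monoid \<O>)"
  shows "map_mat res A \<otimes>\<^bsub>GL \<kappa>\<^esub> map_mat res B = map_mat res (A ** B)"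
proof -
  have c: "A $ i $ j \<in> carrier \<O>" "B $ i $ j \<in> carrier \<O>" for i j
    using assms by (auto simp: matrix_monoid_carrier_iff simp del: int_ring_simps)
  have m: "map_mat res A \<in> carrier (matrix_monoid \<kappa>)" "map_mat res B \<in> carrier (matrix_monoid \<kappa>)"
    using c by (auto simp: matrix_monoid_carrier_iff map_mat_def res_closed simp del: int_ring_simps)
  show ?thesis
    using O.m_closed[OF c(1,2)] \<kappa>.matrix_monoid_mult_2[OF m]
    by (simp add: vec_eq_iff GL_def units_of_def map_mat_def res_simps[OF c(1,2)]
        matrix_matrix_mult_def sum_2 res_simps(2) del: int_ring_simps(1))
qed

lemma matrix_mult_closed:
  fixes A B :: "'a^2^2"
  assumes "A \<in> carrier (matrix_monoid \<O>)" "B \<in> carrier (matrix_monoid \<O>)"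
  shows "A ** B \<in> carrier (matrix_monoid \<O>)"
  using assms unfolding matrix_monoid_carrier_iff matrix_matrix_mult_def
  by (auto simp: sum_2 intro!: K_closed v_add_le v_mult_le)

text \<open>An intertwining matrix over the residue field is lifted entry by entry with arbitrary
  representatives. This works because invertibility is asked of the reduction of \<open>P\<close>,
  and the intertwining relation becomes a congruence between entries.\<close>

lemma isomorphic_residual_reps_iff:
  fixes A B :: "'g \<Rightarrow> 'a^2^2"
  assumes A: "\<And>g. g \<in> carrier G \<Longrightarrow> A g \<in> carrier (matrix_monoid \<O>)"
    and B: "\<And>g. g \<in> carrier G \<Longrightarrow> B g \<in> carrier (matrix_monoid \<O>)"
  shows "isomorphic_reps G \<kappa> (\<lambda>g. map_mat res (A g)) (\<lambda>g. map_mat res (B g)) \<longleftrightarrow>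
    (\<exists>P \<in> carrier (matrix_monoid \<O>). map_mat res P \<in> carrier (GL \<kappa>) \<and>
      (\<forall>g\<in>carrier G. \<forall>i j. (P ** A g) $ i $ j \<asymp> (B g ** P) $ i $ j))"
proof -
  have eq: "map_mat res P \<otimes>\<^bsub>GL \<kappa>\<^esub> map_mat res (A g) = map_mat res (B g) \<otimes>\<^bsub>GL \<kappa>\<^esub> map_mat res P
      \<longleftrightarrow> (\<forall>i j. (P ** A g) $ i $ j \<asymp> (B g ** P) $ i $ j)"
    if P: "P \<in> carrier (matrix_monoid \<O>)" and g: "g \<in> carrier G" for P g
    using matrix_mult_closed[OF P A[OF g]] matrix_mult_closed[OF B[OF g] P]
    unfolding map_mat_res_mult[OF P A[OF g]] map_mat_res_mult[OF B[OF g] P]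
    by (simp add: vec_eq_iff map_mat_def res_eq_iff matrix_monoid_carrier_iff del: int_ring_simps)
  have lift: "\<exists>P\<in>carrier (matrix_monoid \<O>). map_mat res P = Q" if "Q \<in> carrier (GL \<kappa>)" for Q :: "'a set^2^2"
  proof -
    have "\<forall>i j. \<exists>x\<in>carrier \<O>. Q $ i $ j = res x"
      using GL_carrierD[OF that] res_surj by blast
    then obtain f where "\<And>i j. f i j \<in> carrier \<O>" "\<And>i j. Q $ i $ j = res (f i j)" by metis
    then show ?thesis
      by (intro bexI[of _ "\<chi> i j. f i j"])
        (auto simp: map_mat_def vec_eq_iff matrix_monoid_carrier_iff simp del: int_ring_simps)
  qed
  show ?thesis
    unfolding isomorphic_reps_def using eq lift by metis
qed

section \<open>Reductions of upper triangular representations\<close>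

lemma matrix_mult_2_nth:
  "((A :: 'r::semiring_1^2^2) ** B) $ i $ j = A $ i $ 1 * B $ 1 $ j + A $ i $ 2 * B $ 2 $ j"
  by (simp add: matrix_matrix_mult_def sum_2)

lemma res_eq_mult_cancel: "v x = 1 \<Longrightarrow> x * y \<asymp> x * z \<longleftrightarrow> y \<asymp> z"
  by (simp add: res_eq_def mult flip: right_diff_distrib)

text \<open>The matrix argument isolated from the Weil group. In the application, \<alpha> and
  \<beta> are \<open>\<psi>1\<close> and \<open>\<psi>2\<close>, \<gamma> and \<delta> are the
  product of \<psi> with \<omega> and \<psi> itself, \<open>e\<close> is \<open>b1 / d1\<close>,
  \<open>s\<close> is the upper right entry of \<open>\<rho>2\<close>, and \<open>h\<close> is an
  inertia element on which \<open>t\<close> is 1.\<close>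

lemma isomorphic_residual_upper_triangular_iff:
  fixes G :: "'g monoid" and \<alpha> \<beta> \<gamma> \<delta> s :: "'g \<Rightarrow> 'a" and e :: 'a
  defines "A \<equiv> \<lambda>g. mat22 (\<alpha> g) (e * (\<beta> g - \<alpha> g)) 0 (\<beta> g)" and "B \<equiv> \<lambda>g. mat22 (\<gamma> g) (s g) 0 (\<delta> g)"
  assumes A: "\<And>g. g \<in> carrier G \<Longrightarrow> A g \<in> carrier (matrix_monoid \<O>)"
    and B: "\<And>g. g \<in> carrier G \<Longrightarrow> B g \<in> carrier (matrix_monoid \<O>)"
    and h: "h \<in> carrier G" "\<gamma> h = \<delta> h" "v (s h) = 1"
  shows "isomorphic_reps G \<kappa> (\<lambda>g. map_mat res (A g)) (\<lambda>g. map_mat res (B g)) \<longleftrightarrow>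
    (\<forall>g\<in>carrier G. \<gamma> g \<asymp> \<delta> g \<and> \<delta> g \<asymp> \<alpha> g \<and> \<alpha> g \<asymp> \<beta> g) \<and>
    (\<exists>x\<in>Units \<O>. \<forall>g\<in>carrier G. x * (e * (\<beta> g - \<alpha> g)) \<asymp> s g)"
    (is "?iso \<longleftrightarrow> ?diag \<and> ?upper")
proof -
  let ?u = "\<lambda>g. e * (\<beta> g - \<alpha> g)"
  have int: "v (\<alpha> g) \<le> 1" "v (\<beta> g) \<le> 1" "v (\<gamma> g) \<le> 1" "v (\<delta> g) \<le> 1" "v (?u g) \<le> 1" "v (s g) \<le> 1"
    if "g \<in> carrier G" for g
    using A[OF that] B[OF that] by (auto simp: A_def B_def matrix_monoid_carrier_iff forall_2)
  \<comment> \<open>The entries in the order (1,1), (1,2), (2,1), (2,2), which is also the order of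
    the facts \<open>eq\<close> below.\<close>
  have entries: "(\<forall>i j. (P ** A g) $ i $ j \<asymp> (B g ** P) $ i $ j) \<longleftrightarrow>
      P $ 1 $ 1 * \<alpha> g \<asymp> \<gamma> g * P $ 1 $ 1 + s g * P $ 2 $ 1 \<and>
      P $ 1 $ 1 * ?u g + P $ 1 $ 2 * \<beta> g \<asymp> \<gamma> g * P $ 1 $ 2 + s g * P $ 2 $ 2 \<and>
      P $ 2 $ 1 * \<alpha> g \<asymp> \<delta> g * P $ 2 $ 1 \<and>
      P $ 2 $ 1 * ?u g + P $ 2 $ 2 * \<beta> g \<asymp> \<delta> g * P $ 2 $ 2" for P :: "'a^2^2" and g
    by (simp only: A_def B_def forall_2 matrix_mult_2_nth vector_2 mult_zero_left mult_zero_right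
        add_0_left add_0_right conj_assoc)
  have "?iso \<longleftrightarrow> (\<exists>P \<in> carrier (matrix_monoid \<O>). map_mat res P \<in> carrier (GL \<kappa>) \<and>
      (\<forall>g\<in>carrier G. \<forall>i j. (P ** A g) $ i $ j \<asymp> (B g ** P) $ i $ j))"
    using A B by (rule isomorphic_residual_reps_iff)
  note iso = this[unfolded entries]
  show ?thesis
  proof
    assume ?iso
    then obtain P :: "'a^2^2" where P: "P \<in> carrier (matrix_monoid \<O>)" "map_mat res P \<in> carrier (GL \<kappa>)"
      and eq: "\<And>g. g \<in> carrier G \<Longrightarrow> P $ 1 $ 1 * \<alpha> g \<asymp> \<gamma> g * P $ 1 $ 1 + s g * P $ 2 $ 1"
        "\<And>g. g \<in> carrier G \<Longrightarrow> P $ 1 $ 1 * ?u g + P $ 1 $ 2 * \<beta> g \<asymp> \<gamma> g * P $ 1 $ 2 + s g * P $ 2 $ 2"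
        "\<And>g. g \<in> carrier G \<Longrightarrow> P $ 2 $ 1 * \<alpha> g \<asymp> \<delta> g * P $ 2 $ 1"
        "\<And>g. g \<in> carrier G \<Longrightarrow> P $ 2 $ 1 * ?u g + P $ 2 $ 2 * \<beta> g \<asymp> \<delta> g * P $ 2 $ 2"
      unfolding iso by blast
    define a b c d where "a = P $ 1 $ 1" and "b = P $ 1 $ 2" and "c = P $ 2 $ 1" and "d = P $ 2 $ 2"
    note eq = eq[folded a_def b_def c_def d_def]
    have PO: "a \<in> carrier \<O>" "b \<in> carrier \<O>" "c \<in> carrier \<O>" "d \<in> carrier \<O>"
      using P(1) unfolding a_def b_def c_def d_def by (auto simp: matrix_monoid_carrier_iff)
    then have le: "v a \<le> 1" "v b \<le> 1" "v c \<le> 1" "v d \<le> 1" by auto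
    \<comment> \<open>If \<open>c\<close> were a unit, entry (2,1) at \<open>h\<close> would give
      \<open>\<alpha> h \<asymp> \<delta> h = \<gamma> h\<close>; entry (1,1) would then put the
      unit \<open>s h * c\<close> in the maximal ideal.\<close>
    have c: "v c < 1"
    proof (rule ccontr)
      assume "\<not> v c < 1"
      then have vc: "v c = 1" using le by simp
      then have "\<alpha> h \<asymp> \<delta> h" using eq(3)[OF h(1)] by (metis res_eq_mult_cancel mult.commute)
      then have "v (a * (\<alpha> h - \<delta> h)) < 1" using le by (simp add: res_eq_def v_mult_less)
      then have "v (a * (\<alpha> h - \<delta> h) - (a * \<alpha> h - (\<gamma> h * a + s h * c))) < 1"
        using eq(1)[OF h(1)] unfolding res_eq_def by (rule v_diff_less)
      then have "v (s h * c) < 1" using h(2) by (simp add: algebra_simps)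
      then show False using h(3) vc by (simp add: mult)
    qed
    then have "map_mat res P $ 2 $ 1 = \<zero>\<^bsub>\<kappa>\<^esub>"
      using res_eq_iff[OF PO(3) O.zero_closed]
      by (simp add: map_mat_def res_0 res_eq_def flip: c_def)
    then have ad: "v a = 1" "v d = 1"
      using \<kappa>.GL_2_upper_triangular[OF P(2)] res_Units_iff[OF PO(1)] res_Units_iff[OF PO(4)]
      by (simp_all add: map_mat_def flip: a_def d_def)
    \<comment> \<open>The terms containing \<open>c\<close> now vanish modulo the maximal ideal, so
      entry (1,1), and likewise entry (2,2) below, yields a congruence after cancelling the unit
      \<open>a\<close> or \<open>d\<close>.\<close>
    have ag: "\<alpha> g \<asymp> \<gamma> g" if g: "g \<in> carrier G" for g
    proof -
      have "v (a * \<alpha> g - (\<gamma> g * a + s g * c) + s g * c) < 1"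
        using eq(1)[OF g] int(6)[OF g] c by (intro v_add_less v_mult_less) (auto simp: res_eq_def)
      then have "a * \<alpha> g \<asymp> a * \<gamma> g" by (simp add: res_eq_def algebra_simps)
      then show ?thesis using ad by (simp add: res_eq_mult_cancel)
    qed
    have bd: "\<beta> g \<asymp> \<delta> g" if g: "g \<in> carrier G" for g
    proof -
      have "v (c * ?u g + d * \<beta> g - \<delta> g * d - ?u g * c) < 1"
        by (rule v_diff_less[OF eq(4)[OF g, unfolded res_eq_def] v_mult_less[OF int(5)[OF g] c]])
      then have "d * \<beta> g \<asymp> d * \<delta> g" by (simp add: res_eq_def algebra_simps)
      then show ?thesis using ad by (simp add: res_eq_mult_cancel)
    qed
    \<comment> \<open>In entry (1,2) the terms with \<open>b\<close> combine to
      \<open>b * (\<beta> g - \<gamma> g)\<close>. The extra premise holds at \<open>h\<close> by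
      assumption, which is enough to show that \<open>e\<close> is not integral; for the other
      elements it becomes available only with \<open>diag\<close>.\<close>
    have us: "a * ?u g \<asymp> s g * d" if g: "g \<in> carrier G" and "\<gamma> g \<asymp> \<delta> g" for g
    proof -
      have "\<beta> g \<asymp> \<gamma> g" using bd[OF g] that(2) res_eq_trans res_eq_sym by blast
      then have "v (\<beta> g - \<gamma> g) < 1" by (simp add: res_eq_def)
      then have "v (a * ?u g + b * \<beta> g - (\<gamma> g * b + s g * d) - b * (\<beta> g - \<gamma> g)) < 1"
        by (rule v_diff_less[OF eq(2)[OF g, unfolded res_eq_def] v_mult_less[OF le(2)]])
      then show ?thesis by (simp add: res_eq_def algebra_simps)
    qed
    text \<open>
      The unit \<open>?u h\<close> is a multiple of \<open>\<beta> h - \<alpha> h\<close>, which is in the maximal ideal, so \<open>e\<close> is not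
      integral. Hence the integrality of \<open>?u g\<close> forces \<open>\<alpha> g\<close> and \<open>\<beta> g\<close> to be congruent for all \<open>g\<close>.
    \<close>
    have "\<not> v (a * ?u h) < 1"
    proof
      assume "v (a * ?u h) < 1"
      moreover have "v (a * ?u h - s h * d) < 1" using us[of h] h by (simp add: res_eq_def)
      ultimately have "v (a * ?u h - (a * ?u h - s h * d)) < 1" by (rule v_diff_less)
      then show False using h ad by (simp add: mult)
    qed
    then have "\<not> v (?u h) < 1" using ad by (simp add: mult)
    moreover have "v (\<beta> h - \<alpha> h) < 1"
      using ag[OF h(1)] bd[OF h(1)] h(2) res_eq_trans res_eq_sym unfolding res_eq_def[symmetric] by metis
    ultimately have e: "v e > 1"
      using v_mult_less[of e "\<beta> h - \<alpha> h"] by force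
    have ab: "\<alpha> g \<asymp> \<beta> g" if g: "g \<in> carrier G" for g
    proof (rule ccontr)
      assume "\<not> \<alpha> g \<asymp> \<beta> g"
      then have "1 \<le> v (\<beta> g - \<alpha> g)" by (simp add: res_eq_def v_minus_commute)
      then have "v e * 1 \<le> v (?u g)" using e unfolding mult by (intro mult_left_mono) auto
      then show False using int(5)[OF g] e by simp
    qed
    then have diag: ?diag
      using ag bd res_eq_trans res_eq_sym by metis
    moreover have ?upper
    proof (intro bexI[of _ "a * inverse d"] ballI)
      show "a * inverse d \<in> Units \<O>"
        using PO ad by (simp add: Units_int_ring K_closed mult)
      fix g assume g: "g \<in> carrier G"
      have "d \<noteq> 0" using ad by auto
      \<comment> \<open>The congruence is checked after multiplication by the unit \<open>d\<close>,
        where it is entry (1,2).\<close>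
      have "d * (a * inverse d * ?u g) = a * ?u g" using \<open>d \<noteq> 0\<close> by simp
      also have "\<dots> \<asymp> d * s g" using us[OF g] diag g by (simp add: mult.commute)
      finally show "a * inverse d * ?u g \<asymp> s g" using ad res_eq_mult_cancel by blast
    qed
    ultimately show "?diag \<and> ?upper" ..
  next
    assume "?diag \<and> ?upper"
    then obtain x where x: "x \<in> Units \<O>" "\<And>g. g \<in> carrier G \<Longrightarrow> x * ?u g \<asymp> s g" and diag: ?diag by blast
    have xO: "x \<in> carrier \<O>" using x(1) by (simp add: Units_int_ring)
    let ?P = "\<chi> i j. if i = j then if i = 1 then x else 1 else 0 :: 'a^2^2"
    have "map_mat res ?P = (\<chi> i j. if i = j then if i = 1 then res x else \<one>\<^bsub>\<kappa>\<^esub> else \<zero>\<^bsub>\<kappa>\<^esub>)"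
      by (simp add: map_mat_def vec_eq_iff res_0 res_1)
    then have "map_mat res ?P \<in> carrier (GL \<kappa>)"
      using \<kappa>.GL_2_diagonal[of "res x"] x(1) res_Units_iff[OF xO] by (simp add: Units_int_ring)
    moreover have "?P \<in> carrier (matrix_monoid \<O>)"
      using xO by (simp add: matrix_monoid_carrier_iff K_closed)
    \<comment> \<open>For this diagonal matrix, entry (1,2) is the assumption on \<open>x\<close>
      and entry (2,1) is trivial; the two diagonal entries remain.\<close>
    moreover have "x * \<alpha> g \<asymp> \<gamma> g * x" "\<beta> g \<asymp> \<delta> g" if "g \<in> carrier G" for g
    proof -
      have "\<alpha> g \<asymp> \<gamma> g" "\<beta> g \<asymp> \<delta> g" using diag that res_eq_trans res_eq_sym by metis+
      then show "x * \<alpha> g \<asymp> \<gamma> g * x" "\<beta> g \<asymp> \<delta> g"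
        using x(1) by (simp_all add: Units_int_ring res_eq_mult_cancel mult.commute[of _ x])
    qed
    ultimately show ?iso
      unfolding iso using x(2) by (intro bexI[of _ ?P]) auto
  qed
qed

end

section \<open>The criterion for a principal series and a special representation\<close>

theorem theorem3p4:
  fixes p l q :: nat
    and v :: "'a::field_char_0 \<Rightarrow> real" and w :: "'b::field_char_0 \<Rightarrow> real"
    and F :: "'a set" and K :: "'b set"
    and W :: "('a \<Rightarrow> 'a) monoid" and I :: "('a \<Rightarrow> 'a) set"
    and \<Phi> :: "'a \<Rightarrow> 'a"
    and \<omega> t \<psi> \<psi>1 \<psi>2 :: "('a \<Rightarrow> 'a) \<Rightarrow> 'b"
    and \<rho>1 \<rho>2 :: "('a \<Rightarrow> 'a) \<Rightarrow> 'b^2^2"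
    and a1 b1 d1 a2 b2 d2 :: 'b
  assumes "odd p" and "odd l" and "p \<noteq> l"
    and "padic_closure p v" and "padic_closure l w"
    and "finite_ext_of_padics v F" and "finite_ext_of_padics w K"
    and "q = residue_card v F"
    and "W = weil_group v F" and "I = inertia v F"
    and "frobenius_element v F \<Phi>"
    and "\<omega> \<in> hom W (units_of field_of_type)"
    and "\<And>(k::int) \<tau>. \<tau> \<in> I \<Longrightarrow> \<omega> (\<Phi> [^]\<^bsub>W\<^esub> k \<otimes>\<^bsub>W\<^esub> \<tau>) = of_nat q powi (- k)"
    and "t \<in> hom (W\<lparr>carrier := I\<rparr>) (add_monoid (int_ring w (padics w)))"
    and "t ` I = carrier (int_ring w (padics w))"
    and "continuous_map (inertia_topology v F) (val_topology w) t"
    and "\<And>g \<tau>. g \<in> carrier W \<Longrightarrow> \<tau> \<in> I \<Longrightarrow> t (g \<otimes>\<^bsub>W\<^esub> \<tau> \<otimes>\<^bsub>W\<^esub> inv\<^bsub>W\<^esub> g) = \<omega> g * t \<tau>"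
    and "principal_series v F \<Phi> t w \<rho>1 \<psi>1 \<psi>2"
    and "special_rep v F \<Phi> t w \<omega> \<rho>2 \<psi>"
    and "\<rho>1 ` carrier W \<subseteq> carrier (GL (int_ring w K))"
    and "\<rho>2 ` carrier W \<subseteq> carrier (GL (int_ring w K))"
    and "mat22 a1 b1 0 d1 \<in> carrier (GL (field_of_type\<lparr>carrier := K\<rparr>))"
    and "mat22 a2 b2 0 d2 \<in> carrier (GL (field_of_type\<lparr>carrier := K\<rparr>))"
    and "\<And>g. g \<in> carrier W \<Longrightarrow>
           \<rho>1 g = mat22 (\<psi>1 g) (b1 / d1 * (\<psi>2 g - \<psi>1 g)) 0 (\<psi>2 g)"
    and "\<And>(k::int) \<tau> g. \<tau> \<in> I \<Longrightarrow> g = \<Phi> [^]\<^bsub>W\<^esub> k \<otimes>\<^bsub>W\<^esub> \<tau> \<Longrightarrow>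
           \<rho>2 g = mat22 (\<psi> g * \<omega> g)
                        (a2 / d2 * t \<tau> * (\<psi> g * \<omega> g) + b2 / d2 * (\<psi> g - \<psi> g * \<omega> g))
                        0 (\<psi> g)"
    and "a2 / d2 \<in> Units (int_ring w K)"
  shows "isomorphic_reps W (residue_field w K)
           (\<lambda>g. map_mat (residue w K) (\<rho>1 g)) (\<lambda>g. map_mat (residue w K) (\<rho>2 g))
         \<longleftrightarrow>
         [q = 1] (mod l) \<and>
         (\<forall>g \<in> carrier W. residue w K (\<psi> g) = residue w K (\<psi>1 g) \<and>
                          residue w K (\<psi>1 g) = residue w K (\<psi>2 g)) \<and>
         (\<exists>x \<in> Units (int_ring w K). \<forall>(k::int). \<forall>\<tau> \<in> I.
            (let g = \<Phi> [^]\<^bsub>W\<^esub> k \<otimes>\<^bsub>W\<^esub> \<tau> in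
               b1 * x / d1 * (\<psi>2 g - \<psi>1 g)
               - (a2 / d2 * t \<tau> * (\<psi> g * \<omega> g) + b2 / d2 * (\<psi> g - \<psi> g * \<omega> g))
               \<in> max_ideal w K))"
proof -
  note a = assms[unfolded assms(9,10)]
  interpret weil_frobenius p v F \<Phi>
    using a(4,11) by (intro weil_frobenius.intro weil_frobenius_axioms.intro)
  interpret w: valued_subfield l w K
    using a(5,7) by (intro valued_subfield.intro valued_subfield_axioms.intro)
      (auto simp: finite_ext_of_padics_def)
  let ?W = "weil_group v F" and ?I = "inertia v F"
  \<comment> \<open>Reading \<open>s\<close> off from \<open>\<rho>2\<close> makes it a function of
    \<open>g\<close> alone, whereas its formula refers to a decomposition of
    \<open>g\<close>.\<close>
  define e s where "e = b1 / d1" and "s = (\<lambda>g. \<rho>2 g $ 1 $ 2)"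
  have decomp: "\<exists>(k::int) \<tau>. \<tau> \<in> ?I \<and> g = \<Phi> [^]\<^bsub>?W\<^esub> k \<otimes>\<^bsub>?W\<^esub> \<tau>" if "g \<in> carrier ?W" for g
    using that unfolding weil_group_eq by blast
  have W: "\<Phi> [^]\<^bsub>?W\<^esub> k \<otimes>\<^bsub>?W\<^esub> \<tau> \<in> carrier ?W" if "\<tau> \<in> ?I" for k :: int and \<tau>
    using that unfolding weil_group_eq by blast
  have \<rho>1: "\<rho>1 g = mat22 (\<psi>1 g) (e * (\<psi>2 g - \<psi>1 g)) 0 (\<psi>2 g)" if "g \<in> carrier ?W" for g
    using a(24)[OF that] by (simp add: e_def)
  have s: "s g = a2 / d2 * t \<tau> * (\<psi> g * \<omega> g) + b2 / d2 * (\<psi> g - \<psi> g * \<omega> g)"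
    if "\<tau> \<in> ?I" "g = \<Phi> [^]\<^bsub>?W\<^esub> k \<otimes>\<^bsub>?W\<^esub> \<tau>" for k :: int and \<tau> g
    using a(25)[OF that] by (simp add: s_def)
  have \<rho>2: "\<rho>2 g = mat22 (\<psi> g * \<omega> g) (s g) 0 (\<psi> g)" if "g \<in> carrier ?W" for g
    using decomp[OF that] a(25) s by metis
  have GL: "\<rho>1 g \<in> carrier (GL (int_ring w K))" "\<rho>2 g \<in> carrier (GL (int_ring w K))" if "g \<in> carrier ?W" for g
    using a(20,21) that by auto
  have O1: "mat22 (\<psi>1 g) (e * (\<psi>2 g - \<psi>1 g)) 0 (\<psi>2 g) \<in> carrier (matrix_monoid (int_ring w K))"
    if "g \<in> carrier ?W" for g
    using GL_carrierD[OF GL(1)[OF that]] unfolding \<rho>1[OF that] matrix_monoid_carrier_iff by blast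
  have O2: "mat22 (\<psi> g * \<omega> g) (s g) 0 (\<psi> g) \<in> carrier (matrix_monoid (int_ring w K))"
    if "g \<in> carrier ?W" for g
    using GL_carrierD[OF GL(2)[OF that]] unfolding \<rho>2[OF that] matrix_monoid_carrier_iff by blast
  have int: "\<psi>1 g \<in> K" "w (\<psi>1 g) \<le> 1" "e * (\<psi>2 g - \<psi>1 g) \<in> K" "\<psi>2 g \<in> K" "w (\<psi>2 g) \<le> 1"
    "s g \<in> K" "\<psi> g \<in> K" "w (\<psi> g) \<le> 1" if "g \<in> carrier ?W" for g
    using O1[OF that] O2[OF that] by (auto simp: matrix_monoid_carrier_iff forall_2)
  \<comment> \<open>The matrix \<open>\<rho>2 g\<close> is upper triangular and invertible over the
    ring of integers, so its lower right entry is a unit.\<close>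
  have \<psi>_unit: "w (\<psi> g) = 1" if "g \<in> carrier ?W" for g
    using w.O.GL_2_upper_triangular(2)[OF GL(2)[OF that]] \<rho>2[OF that] by (simp add: w.Units_int_ring)
  have "1 \<in> padics w" using w.Rats_padics by auto
  then have "1 \<in> t ` ?I" unfolding a(15) by (simp add: int_ring_def)
  then obtain \<tau> where \<tau>: "\<tau> \<in> ?I" "t \<tau> = 1" by auto
  have \<tau>0: "\<tau> = \<Phi> [^]\<^bsub>?W\<^esub> (0::int) \<otimes>\<^bsub>?W\<^esub> \<tau>" by simp
  then have \<tau>W: "\<tau> \<in> carrier ?W" using W[OF \<tau>(1), of 0] by simp
  \<comment> \<open>Exponent 0 gives \<open>q powi 0 = 1\<close>. Hence the diagonal entries at
    \<tau> coincide, the summand with \<open>b2 / d2\<close> vanishes, and \<open>s \<tau>\<close>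
    is the unit \<open>a2 / d2 * \<psi> \<tau>\<close>.\<close>
  have "\<omega> \<tau> = 1" using a(13)[OF \<tau>(1), of 0] by simp
  then have h: "\<psi> \<tau> * \<omega> \<tau> = \<psi> \<tau>" "w (s \<tau>) = 1"
    using s[OF \<tau>(1) \<tau>0] \<tau>(2) \<psi>_unit[OF \<tau>W] a(26) w.mult[of "a2 / d2" "\<psi> \<tau>"]
    by (simp_all add: w.Units_int_ring)
  have q: "(\<forall>g\<in>carrier ?W. w.res_eq (\<psi> g * \<omega> g) (\<psi> g)) \<longleftrightarrow> [q = 1] (mod l)"
  proof -
    have "(\<forall>g\<in>carrier ?W. w.res_eq (\<psi> g * \<omega> g) (\<psi> g)) \<longleftrightarrow> (\<forall>g\<in>carrier ?W. w.res_eq (\<omega> g) 1)"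
      using w.res_eq_mult_cancel[OF \<psi>_unit, of _ _ 1] by simp
    also have "\<dots> \<longleftrightarrow> w.res_eq (of_nat q) 1"
    proof
      assume "\<forall>g\<in>carrier ?W. w.res_eq (\<omega> g) 1"
      \<comment> \<open>Evaluation at \<open>\<Phi>\<close> itself, written with exponent 1 and the
        identity as inertia element.\<close>
      then have "w.res_eq (of_nat q powi (- 1)) 1"
        using W[OF id_inertia, of 1] a(13)[OF id_inertia, of 1] by metis
      then show "w.res_eq (of_nat q) 1" by (simp add: w.res_eq_inverse_iff)
    next
      assume "w.res_eq (of_nat q) 1"
      then show "\<forall>g\<in>carrier ?W. w.res_eq (\<omega> g) 1"
        using decomp a(13) w.res_eq_powi by metis
    qed
    also have "\<dots> \<longleftrightarrow> [q = 1] (mod l)"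
      using w.res_eq_of_int_iff[of "int q" 1] cong_int_iff[of q 1 l] by simp
    finally show ?thesis .
  qed
  \<comment> \<open>The explicit matrices are known only on the carrier, so they are substituted
    under the bounded quantifier.\<close>
  have "isomorphic_reps ?W (residue_field w K)
           (\<lambda>g. map_mat (residue w K) (\<rho>1 g)) (\<lambda>g. map_mat (residue w K) (\<rho>2 g)) \<longleftrightarrow>
        isomorphic_reps ?W (residue_field w K)
           (\<lambda>g. map_mat (residue w K) (mat22 (\<psi>1 g) (e * (\<psi>2 g - \<psi>1 g)) 0 (\<psi>2 g)))
           (\<lambda>g. map_mat (residue w K) (mat22 (\<psi> g * \<omega> g) (s g) 0 (\<psi> g)))"
    unfolding isomorphic_reps_def using \<rho>1 \<rho>2 by (simp cong: ball_cong)
  also have "\<dots> \<longleftrightarrow>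
    (\<forall>g\<in>carrier ?W. w.res_eq (\<psi> g * \<omega> g) (\<psi> g) \<and> w.res_eq (\<psi> g) (\<psi>1 g) \<and> w.res_eq (\<psi>1 g) (\<psi>2 g)) \<and>
    (\<exists>x\<in>Units (int_ring w K). \<forall>g\<in>carrier ?W. w.res_eq (x * (e * (\<psi>2 g - \<psi>1 g))) (s g))"
    using O1 O2 \<tau>W h
    by (rule w.isomorphic_residual_upper_triangular_iff[where G = ?W and \<alpha> = \<psi>1 and \<beta> = \<psi>2 and \<delta> = \<psi>
          and \<gamma> = "\<lambda>g. \<psi> g * \<omega> g" and e = e and s = s and h = \<tau>])
  finally have iso: "isomorphic_reps ?W (residue_field w K)
      (\<lambda>g. map_mat (residue w K) (\<rho>1 g)) (\<lambda>g. map_mat (residue w K) (\<rho>2 g)) \<longleftrightarrow> \<dots>" .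
  \<comment> \<open>The first congruence is split off and expresses that \<open>q\<close> is 1
    modulo \<open>l\<close>; the other two become equalities of residues because the characters are
    integral.\<close>
  have diag: "(\<forall>g\<in>carrier ?W. w.res_eq (\<psi> g * \<omega> g) (\<psi> g) \<and> w.res_eq (\<psi> g) (\<psi>1 g) \<and> w.res_eq (\<psi>1 g) (\<psi>2 g)) \<longleftrightarrow>
    [q = 1] (mod l) \<and> (\<forall>g\<in>carrier ?W. residue w K (\<psi> g) = residue w K (\<psi>1 g) \<and>
                          residue w K (\<psi>1 g) = residue w K (\<psi>2 g))"
    unfolding q[symmetric] ball_conj_distrib using int by (simp add: w.res_eq_iff cong: ball_cong)
  have upper: "(\<forall>g\<in>carrier ?W. w.res_eq (x * (e * (\<psi>2 g - \<psi>1 g))) (s g)) \<longleftrightarrow>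
      (\<forall>(k::int). \<forall>\<tau> \<in> ?I. (let g = \<Phi> [^]\<^bsub>?W\<^esub> k \<otimes>\<^bsub>?W\<^esub> \<tau> in
               b1 * x / d1 * (\<psi>2 g - \<psi>1 g)
               - (a2 / d2 * t \<tau> * (\<psi> g * \<omega> g) + b2 / d2 * (\<psi> g - \<psi> g * \<omega> g))
               \<in> max_ideal w K))" if "x \<in> Units (int_ring w K)" for x
  proof -
    have "w.res_eq (x * (e * (\<psi>2 g - \<psi>1 g))) (s g) \<longleftrightarrow>
        b1 * x / d1 * (\<psi>2 g - \<psi>1 g)
               - (a2 / d2 * t \<tau> * (\<psi> g * \<omega> g) + b2 / d2 * (\<psi> g - \<psi> g * \<omega> g))
               \<in> max_ideal w K"
      if g: "\<tau> \<in> ?I" "g = \<Phi> [^]\<^bsub>?W\<^esub> k \<otimes>\<^bsub>?W\<^esub> \<tau>" for k :: int and \<tau> g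
    proof -
      have gW: "g \<in> carrier ?W" using W g by blast
      have x: "b1 * x / d1 * (\<psi>2 g - \<psi>1 g) = x * (e * (\<psi>2 g - \<psi>1 g))" by (simp add: e_def)
      show ?thesis
        \<comment> \<open>Membership in \<open>max_ideal\<close> also requires the difference to lie
          in \<open>K\<close>, which follows from the integrality of both representations.\<close>
        unfolding x s[OF g, symmetric] using int[OF gW] \<open>x \<in> Units (int_ring w K)\<close>
        by (simp add: max_ideal_def w.res_eq_def w.Units_int_ring w.K_closed w.K_diff)
    qed
    then show ?thesis unfolding Let_def using decomp W by metis
  qed
  show ?thesis
    unfolding assms(9,10) iso diag conj_assoc by (intro conj_cong bex_cong refl upper)
qed

end
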